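(* Let $G$ be a finite group. Then $$\ker\operatorname{Def}_G=\mathcal S_2(G).$$ Consequently, $$0\longrightarrow\mathcal S_2(G)\longrightarrow V_G\xrightarrow{\ \operatorname{Def}_G\ }\operatorname{im}(\operatorname{Def}_G)\longrightarrow0$$ is exact, and $$\dim_{\mathbb F_2}\mathcal S_2(G)=|\operatorname{Sub}_{\mathrm{ncc}}(G)^c|-\dim_{\mathbb F_2}\operatorname{im}(\operatorname{Def}_G).$$
   Context: For a finite group $G$, $\Omega(G)$ is the Burnside ring, with $\mathbb Z$-basis $[G/H]$, $(H)\in\operatorname{Sub}(G)^c$ (conjugacy classes of subgroups). For $K\le G$, the mark $\varphi_K^G:\Omega(G)\to\mathbb Z$ is the ring homomorphism $[X]\mapsto\#X^K$; $e_H^G\in\mathbb Q\Omega(G)=\mathbb Q\otimes\Omega(G)$ is the primitive idempotent with $\varphi_K^G(e_H^G)=1$ if $(K)=(H)$ and $0$ otherwise, and $e_S:=\sum_{(H)\in S}e_H^G$ for $S\subseteq\operatorname{Sub}(G)^c$. $\operatorname{Sub}_{\mathrm{ncc}}(G)$ is the set of subgroups $H\le G$ with $H/\operatorname{core}_G(H)$ noncyclic, where $\operatorname{core}_G(H)=\bigcap_{g\in G}gHg^{-1}$; $\operatorname{Sub}_{\mathrm{ncc}}(G)^c$ is the set of their $G$-conjugacy classes. $V_G:=\mathbb F_2^{\operatorname{Sub}_{\mathrm{ncc}}(G)^c}$. $\mathcal S_2(G):=\{S\subseteq\operatorname{Sub}_{\mathrm{ncc}}(G)^c\mid 2e_S\in\Omega(G)\}$,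 viewed as a subset of $V_G$ by identifying $S$ with its characteristic function. For a finite group $W$, $\operatorname{Cl}_0(W,\mathbb F_2)$ is the $\mathbb F_2$-space of class functions $f:W\to\mathbb F_2$ with $f(1)=0$, and $\mathfrak D(W):=\operatorname{Cl}_0(W,\mathbb F_2)/\operatorname{Hom}(W,\mathbb F_2)$; $[f]$ is the class of $f$. Put $W_G(K)=N_G(K)/K$. For $x\in V_G$ let $\widetilde x\in\mathbb F_2^{\operatorname{Sub}(G)^c}$ be its extension by $0$. For $K\le G$, $g\in N_G(K)$ put $\lambda_{x,K}(gK)=\widetilde x_{(\langle K,g\rangle)}+\widetilde x_{(K)}$; then $\lambda_{x,K}\in\operatorname{Cl}_0(W_G(K),\mathbb F_2)$. Choosing one representative $K$ of each class, put $\mathfrak D_G:=\bigoplus_{(K)\in\operatorname{Sub}(G)^c}\mathfrak D(W_G(K))$, and define the $\mathbb F_2$-linear map $\operatorname{Def}_G:V_G\to\mathfrak D_G$, $x\mapsto([\lambda_{x,K}])_{(K)}$. Known result available (Yoshida's unit criterion): a conjugation-invariant function $H\mapsto\varepsilon_H\in\{\pm1\}$ on subgroups of $G$ is the mark vector of a unit of $\Omega(G)$ if and only if for every $K\le G$ the map $W_G(K)\to\{\pm1\}$, $gK\mapsto\varepsilon_{\langle K,g\rangle}/\varepsilon_K$, is a group homomorphism. *)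

theory Defs
  imports
    Complex_Main
    "HOL-Library.Z2"
    "HOL-Algebra.Group_Action"
    "HOL-Algebra.Left_Coset"
    "HOL-Algebra.AbelCoset"
    "HOL-Algebra.Elementary_Groups"
    "Jordan_Normal_Form.Missing_VectorSpace"
begin

section \<open>Conjugacy classes of subgroups\<close>

abbreviation subgroups_of :: "('a, 'b) monoid_scheme \<Rightarrow> 'a set set" where
  "subgroups_of G \<equiv> {H. subgroup H G}"

definition conj_action :: "('a, 'b) monoid_scheme \<Rightarrow> 'a \<Rightarrow> 'a set \<Rightarrow> 'a set" where
  "conj_action G = (\<lambda>g. \<lambda>H \<in> subgroups_of G. g <#\<^bsub>G\<^esub> H #>\<^bsub>G\<^esub> (inv\<^bsub>G\<^esub> g))"

definition subgroup_class :: "('a, 'b) monoid_scheme \<Rightarrow> 'a set \<Rightarrow> 'a set set" where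
  "subgroup_class G H = orbit G (conj_action G) H"

definition subgroup_classes :: "('a, 'b) monoid_scheme \<Rightarrow> 'a set set set" where
  "subgroup_classes G = orbits G (subgroups_of G) (conj_action G)"

definition normal_core :: "('a, 'b) monoid_scheme \<Rightarrow> 'a set \<Rightarrow> 'a set" where
  "normal_core G H = (\<Inter>g \<in> carrier G. g <#\<^bsub>G\<^esub> H #>\<^bsub>G\<^esub> (inv\<^bsub>G\<^esub> g))"

definition Sub_ncc :: "('a, 'b) monoid_scheme \<Rightarrow> 'a set set" where
  "Sub_ncc G = {H. subgroup H G \<and> \<not> cyclic_group ((G\<lparr>carrier := H\<rparr>) Mod (normal_core G H))}"

definition ncc_classes :: "('a, 'b) monoid_scheme \<Rightarrow> 'a set set set" where
  "ncc_classes G = subgroup_class G ` Sub_ncc G"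

definition weyl_group :: "('a, 'b) monoid_scheme \<Rightarrow> 'a set \<Rightarrow> 'a set monoid" where
  "weyl_group G K = (G\<lparr>carrier := normalizer G K\<rparr>) Mod K"

section \<open>The Burnside ring\<close>

definition coset_action :: "('a, 'b) monoid_scheme \<Rightarrow> 'a set \<Rightarrow> 'a \<Rightarrow> 'a set \<Rightarrow> 'a set" where
  "coset_action G H = (\<lambda>g. \<lambda>X \<in> lcosets\<^bsub>G\<^esub> H. g <#\<^bsub>G\<^esub> X)"

definition prod_action ::
  "'x set \<Rightarrow> ('a \<Rightarrow> 'x \<Rightarrow> 'x) \<Rightarrow> 'y set \<Rightarrow> ('a \<Rightarrow> 'y \<Rightarrow> 'y) \<Rightarrow> 'a \<Rightarrow> 'x \<times> 'y \<Rightarrow> 'x \<times> 'y" where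
  "prod_action E \<phi> F \<psi> = (\<lambda>g. \<lambda>p \<in> E \<times> F. (\<phi> g (fst p), \<psi> g (snd p)))"

definition fixed_points :: "'x set \<Rightarrow> ('a \<Rightarrow> 'x \<Rightarrow> 'x) \<Rightarrow> 'a set \<Rightarrow> 'x set" where
  "fixed_points E \<phi> K = {x \<in> E. \<forall>k \<in> K. \<phi> k x = x}"

text \<open>
  The Burnside ring is the free module on the basis \<open>[G/H]\<close>, one basis element for each conjugacy
  class \<open>(H)\<close>; an element is the family of its coordinates in that basis.  The integral Burnside
  ring is the case of coefficients \<^typ>\<open>int\<close>, and its extension of scalars to the rationals is the
  case of coefficients \<^typ>\<open>rat\<close>.

  The class \<open>[X]\<close> of a finite \<open>G\<close>-set has as coordinate at \<open>(H)\<close> the number of orbits of \<open>X\<close>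
  isomorphic to \<open>G/H\<close>; the orbit of \<open>x\<close> is isomorphic to \<open>G/H\<close> iff the stabilizer of \<open>x\<close> is
  conjugate to \<open>H\<close>.
\<close>

definition gset_class ::
  "('a, 'b) monoid_scheme \<Rightarrow> 'x set \<Rightarrow> ('a \<Rightarrow> 'x \<Rightarrow> 'x) \<Rightarrow> 'a set set \<Rightarrow> 'r::comm_ring_1" where
  "gset_class G E \<phi> =
     (\<lambda>C \<in> subgroup_classes G. of_nat (card {Y \<in> orbits G E \<phi>. \<exists>x \<in> Y. stabilizer G \<phi> x \<in> C}))"

definition class_rep :: "'a set set \<Rightarrow> 'a set" where
  "class_rep C = (SOME H. H \<in> C)"

text \<open>
  Multiplication is the bilinear extension of \<open>[G/H] [G/K] = [G/H \<times> G/K]\<close>.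
\<close>

definition burnside_ring :: "('a, 'b) monoid_scheme \<Rightarrow> ('a set set \<Rightarrow> 'r::comm_ring_1) ring" where
  "burnside_ring G =
     \<lparr>carrier = subgroup_classes G \<rightarrow>\<^sub>E UNIV,
      mult = (\<lambda>x y. \<lambda>C \<in> subgroup_classes G.
        \<Sum>A \<in> subgroup_classes G. \<Sum>B \<in> subgroup_classes G. x A * y B *
          gset_class G ((lcosets\<^bsub>G\<^esub> (class_rep A)) \<times> (lcosets\<^bsub>G\<^esub> (class_rep B)))
            (prod_action (lcosets\<^bsub>G\<^esub> (class_rep A)) (coset_action G (class_rep A))
                         (lcosets\<^bsub>G\<^esub> (class_rep B)) (coset_action G (class_rep B))) C),
      one = gset_class G (lcosets\<^bsub>G\<^esub> (carrier G)) (coset_action G (carrier G)),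
      zero = (\<lambda>C \<in> subgroup_classes G. 0),
      add = (\<lambda>x y. \<lambda>C \<in> subgroup_classes G. x C + y C)\<rparr>"

abbreviation burnside_int :: "('a, 'b) monoid_scheme \<Rightarrow> ('a set set \<Rightarrow> int) ring" where
  "burnside_int G \<equiv> burnside_ring G"

abbreviation burnside_rat :: "('a, 'b) monoid_scheme \<Rightarrow> ('a set set \<Rightarrow> rat) ring" where
  "burnside_rat G \<equiv> burnside_ring G"

definition burnside_incl :: "('a, 'b) monoid_scheme \<Rightarrow> ('a set set \<Rightarrow> int) \<Rightarrow> 'a set set \<Rightarrow> rat" where
  "burnside_incl G u = (\<lambda>C \<in> subgroup_classes G. of_int (u C))"

text \<open>The mark at \<open>K\<close> is the linear extension of \<open>[G/H] \<mapsto> #(G/H)\<^sup>K\<close>.\<close>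

definition mark :: "('a, 'b) monoid_scheme \<Rightarrow> 'a set \<Rightarrow> ('a set set \<Rightarrow> 'r::comm_ring_1) \<Rightarrow> 'r" where
  "mark G K x = (\<Sum>C \<in> subgroup_classes G. x C *
     of_nat (card (fixed_points (lcosets\<^bsub>G\<^esub> (class_rep C)) (coset_action G (class_rep C)) K)))"

definition idempotent :: "('r, 's) ring_scheme \<Rightarrow> 'r \<Rightarrow> bool" where
  "idempotent R e \<longleftrightarrow> e \<in> carrier R \<and> e \<otimes>\<^bsub>R\<^esub> e = e"

definition primitive_idempotent :: "('r, 's) ring_scheme \<Rightarrow> 'r \<Rightarrow> bool" where
  "primitive_idempotent R e \<longleftrightarrow> idempotent R e \<and> e \<noteq> \<zero>\<^bsub>R\<^esub> \<and>
     (\<forall>a b. idempotent R a \<and> idempotent R b \<and> a \<otimes>\<^bsub>R\<^esub> b = \<zero>\<^bsub>R\<^esub> \<and> b \<otimes>\<^bsub>R\<^esub> a = \<zero>\<^bsub>R\<^esub> \<and> a \<oplus>\<^bsub>R\<^esub> b = e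
        \<longrightarrow> a = \<zero>\<^bsub>R\<^esub> \<or> b = \<zero>\<^bsub>R\<^esub>)"

definition burnside_idem :: "('a, 'b) monoid_scheme \<Rightarrow> 'a set set \<Rightarrow> 'a set set \<Rightarrow> rat" where
  "burnside_idem G C = (THE e. primitive_idempotent (burnside_rat G) e \<and>
     (\<forall>K. subgroup K G \<longrightarrow> mark G K e = (if subgroup_class G K = C then 1 else 0)))"

definition burnside_idem_set :: "('a, 'b) monoid_scheme \<Rightarrow> 'a set set set \<Rightarrow> 'a set set \<Rightarrow> rat" where
  "burnside_idem_set G S = (\<Oplus>\<^bsub>burnside_rat G\<^esub> C \<in> S. burnside_idem G C)"

definition S2_sets :: "('a, 'b) monoid_scheme \<Rightarrow> 'a set set set set" where
  "S2_sets G = {S. S \<subseteq> ncc_classes G \<and>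
     [(2::nat)] \<cdot>\<^bsub>burnside_rat G\<^esub> burnside_idem_set G S \<in> burnside_incl G ` carrier (burnside_int G)}"

section \<open>Vector spaces over the field with two elements\<close>

definition F2 :: "bit ring" where
  "F2 = \<lparr>carrier = UNIV, mult = (*), one = 1, zero = 0, add = (+)\<rparr>"

definition V_space :: "('a, 'b) monoid_scheme \<Rightarrow> (bit, 'a set set \<Rightarrow> bit) module" where
  "V_space G = ring.func_space F2 (ncc_classes G)"

definition S2 :: "('a, 'b) monoid_scheme \<Rightarrow> ('a set set \<Rightarrow> bit) set" where
  "S2 G = (\<lambda>S. \<lambda>C \<in> ncc_classes G. of_bool (C \<in> S)) ` S2_sets G"

definition quotient_module ::
  "('k, 'm, 'c) module_scheme \<Rightarrow> 'm set \<Rightarrow> ('k, 'm set) module" where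
  "quotient_module M N =
     \<lparr>carrier = a_rcosets\<^bsub>M\<^esub> N, mult = undefined, one = undefined,
      zero = N, add = (<+>\<^bsub>M\<^esub>), smult = (\<lambda>c X. \<Union>x \<in> X. N +>\<^bsub>M\<^esub> (c \<odot>\<^bsub>M\<^esub> x))\<rparr>"

text \<open>Direct sum of a finite family; the index set is finite in all uses, so that no support
  condition is needed.\<close>

definition family_direct_sum ::
  "'i set \<Rightarrow> ('i \<Rightarrow> ('k, 'm, 'c) module_scheme) \<Rightarrow> ('k, 'i \<Rightarrow> 'm) module" where
  "family_direct_sum I M =
     \<lparr>carrier = (\<Pi>\<^sub>E i \<in> I. carrier (M i)), mult = undefined, one = undefined,
      zero = (\<lambda>i \<in> I. \<zero>\<^bsub>M i\<^esub>),
      add = (\<lambda>x y. \<lambda>i \<in> I. x i \<oplus>\<^bsub>M i\<^esub> y i),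
      smult = (\<lambda>c x. \<lambda>i \<in> I. c \<odot>\<^bsub>M i\<^esub> x i)\<rparr>"

definition Cl0 :: "('w, 'b) monoid_scheme \<Rightarrow> (bit, 'w \<Rightarrow> bit) module" where
  "Cl0 W = (ring.func_space F2 (carrier W))
     \<lparr>carrier := {f \<in> carrier W \<rightarrow>\<^sub>E carrier F2. f \<one>\<^bsub>W\<^esub> = 0 \<and>
        (\<forall>g \<in> carrier W. \<forall>h \<in> carrier W. f (g \<otimes>\<^bsub>W\<^esub> h \<otimes>\<^bsub>W\<^esub> inv\<^bsub>W\<^esub> g) = f h)}\<rparr>"

definition HomF2 :: "('w, 'b) monoid_scheme \<Rightarrow> ('w \<Rightarrow> bit) set" where
  "HomF2 W = hom W (add_monoid F2) \<inter> extensional (carrier W)"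

definition Dfrak :: "('w, 'b) monoid_scheme \<Rightarrow> (bit, ('w \<Rightarrow> bit) set) module" where
  "Dfrak W = quotient_module (Cl0 W) (HomF2 W)"

definition Dfrak_class :: "('w, 'b) monoid_scheme \<Rightarrow> ('w \<Rightarrow> bit) \<Rightarrow> ('w \<Rightarrow> bit) set" where
  "Dfrak_class W f = HomF2 W +>\<^bsub>Cl0 W\<^esub> f"

section \<open>The map Def\<close>

definition zero_ext :: "('a, 'b) monoid_scheme \<Rightarrow> ('a set set \<Rightarrow> bit) \<Rightarrow> 'a set set \<Rightarrow> bit" where
  "zero_ext G x = (\<lambda>C \<in> subgroup_classes G. if C \<in> ncc_classes G then x C else 0)"

text \<open>For a coset \<open>X = gK\<close> the subgroup \<open>\<langle>K, g\<rangle>\<close> is the one generated by \<open>K \<union> X\<close>.\<close>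

definition lambda_fun ::
  "('a, 'b) monoid_scheme \<Rightarrow> ('a set set \<Rightarrow> bit) \<Rightarrow> 'a set \<Rightarrow> 'a set \<Rightarrow> bit" where
  "lambda_fun G x K = (\<lambda>X \<in> carrier (weyl_group G K).
     zero_ext G x (subgroup_class G (generate G (K \<union> X))) + zero_ext G x (subgroup_class G K))"

lemma (in group) generate_Un_coset:
  assumes "subgroup K G" "g \<in> carrier G"
  shows "generate G (K \<union> (K #> g)) = generate G (insert g K)"
proof (rule equalityI)
  have sub: "insert g K \<subseteq> carrier G"
    using assms subgroup.subset by blast
  have "K \<union> (K #> g) \<subseteq> generate G (insert g K)"
    unfolding r_coset_def by (auto intro!: generate.eng intro: generate.incl)
  then show "generate G (K \<union> (K #> g)) \<subseteq> generate G (insert g K)"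
    by (rule generate_subgroup_incl[OF _ generate_is_subgroup[OF sub]])
  have "g \<in> K #> g"
    using assms rcos_self by blast
  then show "generate G (insert g K) \<subseteq> generate G (K \<union> (K #> g))"
    by (intro mono_generate) auto
qed

text \<open>In the following, \<open>r\<close> assigns to each conjugacy class of subgroups a chosen representative.\<close>

definition D_space ::
  "('a, 'b) monoid_scheme \<Rightarrow> ('a set set \<Rightarrow> 'a set) \<Rightarrow>
     (bit, 'a set set \<Rightarrow> ('a set \<Rightarrow> bit) set) module" where
  "D_space G r = family_direct_sum (subgroup_classes G) (\<lambda>C. Dfrak (weyl_group G (r C)))"

definition Def ::
  "('a, 'b) monoid_scheme \<Rightarrow> ('a set set \<Rightarrow> 'a set) \<Rightarrow>
     ('a set set \<Rightarrow> bit) \<Rightarrow> 'a set set \<Rightarrow> ('a set \<Rightarrow> bit) set" where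
  "Def G r x = (\<lambda>C \<in> subgroup_classes G. Dfrak_class (weyl_group G (r C)) (lambda_fun G x (r C)))"

text \<open>Exactness of \<open>0 \<rightarrow> A \<rightarrow> B \<rightarrow> C \<rightarrow> 0\<close> with maps \<open>f\<close> and \<open>g\<close>.  The library's notion of short exact
  sequence requires all groups to have the same element type.\<close>

definition short_exact_vs ::
  "('k, 'c) ring_scheme \<Rightarrow> ('k, 'x, 'd) module_scheme \<Rightarrow> ('k, 'y, 'e) module_scheme \<Rightarrow>
     ('k, 'z, 'f) module_scheme \<Rightarrow> ('x \<Rightarrow> 'y) \<Rightarrow> ('y \<Rightarrow> 'z) \<Rightarrow> bool" where
  "short_exact_vs K A B C f g \<longleftrightarrow>
     linear_map K A B f \<and> linear_map K B C g \<and>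
     mod_hom.ker A B f = {\<zero>\<^bsub>A\<^esub>} \<and>
     mod_hom.im A f = mod_hom.ker B C g \<and>
     mod_hom.im B g = carrier C"

end

(*
  Let x have support S. If u in the Burnside ring has marks 2 on S and 0 elsewhere, then on the
  K-fixed points N_G(K) acts by a virtual permutation representation whose character takes only the
  values 0 and 2. Counting cycles, each element then has virtually no cycles of length greater than 2
  and at most one 2-cycle up to sign, so that gK |-> lambda_{x,K}(gK) is the determinant of this
  representation, hence a homomorphism. Conversely, if every lambda_{x,K} is a homomorphism, then its
  fibres have 0, |W|/2 or |W| elements, so twice the characteristic function of S satisfies the Burnside
  congruences modulo |W_G(K)|; as the table of marks is triangular with diagonal entries |W_G(K)|,
  these congruences suffice for an integral element with these marks to exist.
*)

theory Submission
  imports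
    Defs
    "HOL-Combinatorics.Cycles"
    "HOL-Algebra.Zassenhaus"
    "HOL-Algebra.Multiplicative_Group"
begin

section \<open>Signs and cycle types of permutations\<close>

text \<open>The kernel condition is Yoshida's criterion for 1 - 2e_S in additive form: the marks 0
  and 2 of 2e_S become the signs 1 and -1, and the quotient of the signs at \<open><K, g>\<close>
  and K becomes \<lambda>. The obstacle in the first direction is that an element of the Burnside
  ring is only a difference of permutation representations, so its cycle counts may be negative. The
  mark at g alone does not control them; the marks at all powers of g do. They force the virtual
  number of d-cycles to be 0 for d >= 3, and comparing g with its square then isolates the 2-cycles.
  The elimination along the table of marks serves twice. Over the rationals it produces the
  idempotents, whose definition by description calls for existence and uniqueness; over the integers
  it runs under the congruences. These are demanded at one representative of each class only, which
  is what the vanishing of Def supplies.\<close>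

lemma evenperm_cycle_of_list:
  assumes "distinct cs"
  shows "evenperm (cycle_of_list cs) \<longleftrightarrow> even (length cs - 1)"
  using assms
proof (induction cs rule: cycle_of_list.induct)
  case (1 i j cs)
  then have "i \<noteq> j" "evenperm (cycle_of_list (j # cs)) \<longleftrightarrow> even (length (j # cs) - 1)"
    by auto
  then show ?case
    using evenperm_comp[OF permutation_swap_id[of i j] permutation_of_cycle[of "j # cs"]]
    by (simp add: evenperm_swap del: comp_apply)
qed (simp_all add: id_def[symmetric])

lemma cycle_of_list_funpow_nth:
  assumes "distinct cs" "j < length cs"
  shows "(cycle_of_list cs ^^ i) (cs ! j) = cs ! ((i + j) mod length cs)"
proof -
  have "map (cycle_of_list cs ^^ i) cs ! j = rotate i cs ! j"
    using cyclic_rotation[OF assms(1)] by simp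
  then show ?thesis
    using assms(2) by (simp add: nth_rotate)
qed

text \<open>On positions modulo the length n the i-th power is the shift by i: it fixes every point
  if n divides i, and no point otherwise.\<close>

lemma card_fixed_cycle_of_list_funpow:
  assumes "distinct cs"
  shows "card {x \<in> set cs. (cycle_of_list cs ^^ i) x = x} = (if length cs dvd i then length cs else 0)"
proof -
  have "(cycle_of_list cs ^^ i) (cs ! j) = cs ! j \<longleftrightarrow> length cs dvd i" if "j < length cs" for j
  proof -
    have "(cycle_of_list cs ^^ i) (cs ! j) = cs ! j \<longleftrightarrow> (i + j) mod length cs = j"
      using nth_eq_iff_index_eq[OF assms mod_less_divisor that, of "i + j"]
        cycle_of_list_funpow_nth[OF assms that] that by force
    also have "\<dots> \<longleftrightarrow> length cs dvd i"
      using that mod_eq_dvd_iff_nat[of j "i + j" "length cs"] by simp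
    finally show ?thesis .
  qed
  then have "{x \<in> set cs. (cycle_of_list cs ^^ i) x = x} = (if length cs dvd i then set cs else {})"
    by (auto simp: in_set_conv_nth)
  then show ?thesis
    using assms by (simp add: distinct_card)
qed

text \<open>The number \<open>a d\<close> counts the cycles of length \<open>d\<close>.\<close>

lemma permutation_cycle_type:
  assumes "p permutes S" "finite S"
  shows "\<exists>a :: nat \<Rightarrow> nat.
      (\<forall>i > 0. card {x \<in> S. (p ^^ i) x = x} = (\<Sum>d | d dvd i. d * a d)) \<and>
      (\<forall>N \<ge> card S. evenperm p \<longleftrightarrow> even (\<Sum>d = 1..N. (d - 1) * a d))"
  using cycle_decomposition[OF assms]
proof induction
  case empty
  show ?case by (intro exI[of _ "\<lambda>_. 0"]) auto
next
  case (comp I p cs)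
  \<comment> \<open>The decomposition hands over its parts, but not that \<open>p\<close> moves only
    points of \<open>I\<close>; a separate induction supplies this.\<close>
  have "p permutes I \<and> finite I"
    using comp.hyps(1)
  proof induction
    case (comp I p cs)
    then show ?case
      using permutes_compose[of p "set cs \<union> I" "cycle_of_list cs"]
        permutes_subset[OF cycle_permutes[of cs], of "set cs \<union> I"]
        permutes_subset[of p I "set cs \<union> I"] by blast
  qed (simp add: id_def[symmetric] permutes_id)
  then have pI: "p permutes I" and finI: "finite I"
    by auto
  show ?case
  \<comment> \<open>The decomposition may contain the empty list, whose cycle is the identity and
    must not be counted.\<close>
  proof (cases "cs = []")
    case True
    then show ?thesis using comp.IH by (simp add: id_def[symmetric])
  next
    case False
    obtain a where a:
      "\<And>i. 0 < i \<Longrightarrow> card {x \<in> I. (p ^^ i) x = x} = (\<Sum>d | d dvd i. d * a d)"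
      "\<And>N. card I \<le> N \<Longrightarrow> evenperm p \<longleftrightarrow> even (\<Sum>d = 1..N. (d - 1) * a d)"
      using comp.IH by blast
    let ?c = "cycle_of_list cs" and ?n = "length cs"
    define b where "b d = a d + (if d = ?n then 1 else 0)" for d
    have n: "1 \<le> ?n" using False by (cases cs) auto
    have cardU: "card (set cs \<union> I) = ?n + card I"
      using comp.hyps finI by (simp add: card_Un_disjoint distinct_card)
    have cs_inv: "?c x \<in> set cs" if "x \<in> set cs" for x
      using that cycle_permutes permutes_in_image by fastforce
    have I_inv: "p x \<in> I" if "x \<in> I" for x
      using that pI permutes_in_image by fastforce
    have on_cs: "((?c \<circ> p) ^^ i) x = (?c ^^ i) x \<and> (?c ^^ i) x \<in> set cs" if "x \<in> set cs" for x i
    proof (induction i)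
      case (Suc i)
      then have "(?c ^^ i) x \<notin> I" using comp.hyps(3) by blast
      then have "p ((?c ^^ i) x) = (?c ^^ i) x" using pI by (simp add: permutes_not_in)
      then show ?case using Suc cs_inv by simp
    qed (use that in auto)
    have on_I: "((?c \<circ> p) ^^ i) x = (p ^^ i) x \<and> (p ^^ i) x \<in> I" if "x \<in> I" for x i
    proof (induction i)
      case (Suc i)
      then have "p ((p ^^ i) x) \<in> I" using I_inv by blast
      then have "p ((p ^^ i) x) \<notin> set cs" using comp.hyps(3) by blast
      then show ?case using Suc \<open>p ((p ^^ i) x) \<in> I\<close> by (simp add: id_outside_supp)
    qed (use that in auto)
    have "card {x \<in> set cs \<union> I. ((?c \<circ> p) ^^ i) x = x} = (\<Sum>d | d dvd i. d * b d)" if "0 < i" for i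
    proof -
      have "{x \<in> set cs \<union> I. ((?c \<circ> p) ^^ i) x = x}
          = {x \<in> set cs. (?c ^^ i) x = x} \<union> {x \<in> I. (p ^^ i) x = x}"
        using on_cs on_I by auto
      then have "card {x \<in> set cs \<union> I. ((?c \<circ> p) ^^ i) x = x}
          = card {x \<in> set cs. (?c ^^ i) x = x} + card {x \<in> I. (p ^^ i) x = x}"
        using comp.hyps(3) finI by (auto intro!: card_Un_disjoint)
      also have "\<dots> = (\<Sum>d | d dvd i. (if d = ?n then ?n else 0)) + (\<Sum>d | d dvd i. d * a d)"
        using that comp.hyps(2) a(1) by (simp add: card_fixed_cycle_of_list_funpow)
      also have "\<dots> = (\<Sum>d | d dvd i. d * b d)"
        unfolding sum.distrib[symmetric] by (rule sum.cong) (auto simp: b_def distrib_left)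
      finally show ?thesis .
    qed
    \<comment> \<open>Any bound N at least the degree sees every cycle length. It stays free so that
      permutations of different degrees can share one bound.\<close>
    moreover have "evenperm (?c \<circ> p) \<longleftrightarrow> even (\<Sum>d = 1..N. (d - 1) * b d)"
      if N: "card (set cs \<union> I) \<le> N" for N
    proof -
      have "permutation p"
        using pI finI permutation_permutes by blast
      then have "evenperm (?c \<circ> p) \<longleftrightarrow> (even (?n - 1) \<longleftrightarrow> even (\<Sum>d = 1..N. (d - 1) * a d))"
        using a(2)[of N] N cardU evenperm_comp[OF permutation_of_cycle[of cs], of p]
          evenperm_cycle_of_list[OF comp.hyps(2)] by linarith
      moreover have "(\<Sum>d = 1..N. (d - 1) * b d)
          = (\<Sum>d = 1..N. if d = ?n then ?n - 1 else 0) + (\<Sum>d = 1..N. (d - 1) * a d)"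
        unfolding sum.distrib[symmetric] by (rule sum.cong) (auto simp: b_def distrib_left)
      moreover have "(\<Sum>d = 1..N. if d = ?n then ?n - 1 else 0) = ?n - 1"
        using N cardU n by simp
      ultimately show ?thesis by simp
    qed
    ultimately show ?thesis
      by (intro exI[of _ b] conjI allI impI)
  qed
qed

text \<open>A virtual permutation with cycle type \<open>A\<close> whose powers have only marks \<open>0\<close> and \<open>2\<close> is, up to
  fixed points, a multiple of a transposition.\<close>

lemma virtual_cycle_type_vanishes:
  fixes A :: "nat \<Rightarrow> int"
  assumes "\<And>i. 0 < i \<Longrightarrow> (\<Sum>d | d dvd i. int d * A d) \<in> {0, 2}"
  shows "3 \<le> i \<Longrightarrow> A i = 0"
proof (induction i rule: less_induct)
  case (less i)
  let ?f = "\<lambda>i. \<Sum>d | d dvd i. int d * A d"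
  have fin: "finite {d. d dvd i}" using less.prems by simp
  \<comment> \<open>\<open>j\<close> is the largest divisor of i among 1 and 2. By induction the
    other proper divisors contribute nothing, so \<open>int i * A i\<close> is the difference of the
    sums at i and j, both in {0, 2}. A nonzero multiple of i >= 3 is too large for that.\<close>
  define j :: nat where "j = (if even i then 2 else 1)"
  have j: "0 < j" "j dvd i" "j < i" using less.prems by (auto simp: j_def)
  have "?f i = (\<Sum>d \<in> insert i {d. d dvd j}. int d * A d)"
  proof (rule sum.mono_neutral_right[OF fin])
    show "insert i {d. d dvd j} \<subseteq> {d. d dvd i}" using j by (auto intro: dvd_trans)
    show "\<forall>d \<in> {d. d dvd i} - insert i {d. d dvd j}. int d * A d = 0"
    proof
      fix d assume d: "d \<in> {d. d dvd i} - insert i {d. d dvd j}"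
      then have "d \<noteq> 0" "d < i" using less.prems by (auto dest: dvd_imp_le simp: le_neq_implies_less)
      moreover have "d \<noteq> 1" using d by auto
      moreover have "d \<noteq> 2" using d by (auto simp: j_def)
      ultimately show "int d * A d = 0" using less.IH[of d] by simp
    qed
  qed
  also have "\<dots> = int i * A i + ?f j"
    using j by (subst sum.insert) (auto dest: dvd_imp_le)
  finally have "int i * A i = ?f i - ?f j" by simp
  moreover have "?f i \<in> {0, 2}" "?f j \<in> {0, 2}"
    using assms[of i] assms[of j] j less.prems by auto
  ultimately have "\<bar>int i * A i\<bar> \<le> 2" by auto
  show ?case
  proof (rule ccontr)
    assume "A i \<noteq> 0"
    then have "int i * 1 \<le> int i * \<bar>A i\<bar>" by (intro mult_left_mono) auto
    moreover have "int i * \<bar>A i\<bar> \<le> 2" using \<open>\<bar>int i * A i\<bar> \<le> 2\<close> by (simp add: abs_mult)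
    ultimately show False using less.prems by linarith
  qed
qed

text \<open>The parity on the left is that of the sign (determinant) of the virtual permutation.\<close>

lemma virtual_sign_from_marks:
  fixes u :: "'c \<Rightarrow> int" and X :: "'c \<Rightarrow> 'x set"
  assumes "finite I" and fin: "\<And>c. c \<in> I \<Longrightarrow> finite (X c)"
    and perm: "\<And>c. c \<in> I \<Longrightarrow> p c permutes X c"
    and f: "\<And>i. f i = (\<Sum>c \<in> I. u c * int (card {x \<in> X c. (p c ^^ i) x = x}))"
    and f02: "\<And>i. 0 < i \<Longrightarrow> f i \<in> {0, 2}"
  shows "0 < k \<Longrightarrow> f (2 * k) = f 2"
    and "even (\<Sum>c \<in> I. u c * of_bool (\<not> evenperm (p c))) \<longleftrightarrow> f 1 = f 2"
proof -
  have "\<forall>c \<in> I. \<exists>a :: nat \<Rightarrow> nat.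
      (\<forall>i > 0. card {x \<in> X c. (p c ^^ i) x = x} = (\<Sum>d | d dvd i. d * a d)) \<and>
      (\<forall>N \<ge> card (X c). evenperm (p c) \<longleftrightarrow> even (\<Sum>d = 1..N. (d - 1) * a d))"
    using permutation_cycle_type[OF perm fin] by simp
  from bchoice[OF this] obtain a :: "'c \<Rightarrow> nat \<Rightarrow> nat" where
    a2: "\<And>c i. c \<in> I \<Longrightarrow> 0 < i \<Longrightarrow> card {x \<in> X c. (p c ^^ i) x = x} = (\<Sum>d | d dvd i. d * a c d)" and
    a3: "\<And>c N. c \<in> I \<Longrightarrow> card (X c) \<le> N \<Longrightarrow> evenperm (p c) \<longleftrightarrow> even (\<Sum>d = 1..N. (d - 1) * a c d)"
    by blast
  \<comment> \<open>The virtual number of d-cycles, possibly negative.\<close>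
  define A where "A d = (\<Sum>c \<in> I. u c * int (a c d))" for d
  have fA: "f i = (\<Sum>d | d dvd i. int d * A d)" if "0 < i" for i
  proof -
    have "f i = (\<Sum>c \<in> I. \<Sum>d | d dvd i. u c * (int d * int (a c d)))"
      using that by (simp add: f a2 sum_distrib_left)
    also have "\<dots> = (\<Sum>d | d dvd i. \<Sum>c \<in> I. u c * (int d * int (a c d)))"
      by (rule sum.swap)
    finally show ?thesis
      by (simp add: A_def sum_distrib_left mult.left_commute)
  qed
  have A0: "A i = 0" if "3 \<le> i" for i
    using virtual_cycle_type_vanishes[of A] f02 fA that by metis
  have divs2: "{d :: nat. d dvd 2} = {1, 2}"
  proof -
    have "d = 1 \<or> d = 2" if "d dvd 2" for d :: nat
      using dvd_imp_le[OF that] that by (cases "d = 0") auto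
    then show ?thesis by auto
  qed
  have f1: "f 1 = A 1" and f2: "f 2 = A 1 + 2 * A 2"
    using fA[of 1] fA[of 2] by (simp_all add: divs2)
  \<comment> \<open>Every even power fixes all points on cycles of length 1 and 2, and virtually no
    other cycles are left.\<close>
  show "f (2 * k) = f 2" if "0 < k"
  proof -
    have "f (2 * k) = (\<Sum>d \<in> {1, 2}. int d * A d)"
      unfolding fA[OF mult_pos_pos[OF zero_less_numeral that]]
    proof (rule sum.mono_neutral_right)
      show "\<forall>d \<in> {d. d dvd 2 * k} - {1, 2}. int d * A d = 0"
      proof
        fix d assume d: "d \<in> {d. d dvd 2 * k} - {1, 2}"
        then have "d \<noteq> 0" using that by (intro notI) simp
        then have "3 \<le> d" using d by simp
        then show "int d * A d = 0" by (simp add: A0)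
      qed
    qed (use that in auto)
    then show ?thesis using f2 by simp
  qed
  \<comment> \<open>A bound common to all \<open>X c\<close>; 2 is inserted so that the term d = 2
    is always in range.\<close>
  define N where "N = Max (insert 2 ((\<lambda>c. card (X c)) ` I))"
  have N: "2 \<le> N" "\<And>c. c \<in> I \<Longrightarrow> card (X c) \<le> N"
    unfolding N_def using \<open>finite I\<close> by auto
  have "even (\<Sum>c \<in> I. u c * of_bool (\<not> evenperm (p c)))
      \<longleftrightarrow> even (\<Sum>c \<in> I. u c * (\<Sum>d = 1..N. int (d - 1) * int (a c d)))"
  proof -
    have "even (u c * of_bool (\<not> evenperm (p c)) - u c * (\<Sum>d = 1..N. int (d - 1) * int (a c d)))"
      if "c \<in> I" for c
    proof -
      have "(\<Sum>d = 1..N. int (d - 1) * int (a c d)) = int (\<Sum>d = 1..N. (d - 1) * a c d)"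
        by simp
      then have "even (\<Sum>d = 1..N. int (d - 1) * int (a c d)) \<longleftrightarrow> evenperm (p c)"
        using a3[OF that N(2)[OF that]] by (metis even_of_nat)
      then show ?thesis by auto
    qed
    then have "even (\<Sum>c \<in> I. u c * of_bool (\<not> evenperm (p c)) - u c * (\<Sum>d = 1..N. int (d - 1) * int (a c d)))"
      by (intro dvd_sum) auto
    then show ?thesis by (simp add: sum_subtractf)
  qed
  also have "(\<Sum>c \<in> I. u c * (\<Sum>d = 1..N. int (d - 1) * int (a c d))) = (\<Sum>d = 1..N. int (d - 1) * A d)"
    unfolding A_def sum_distrib_left by (subst sum.swap) (simp add: mult.left_commute)
  \<comment> \<open>Fixed points have weight 0 and longer cycles have virtual number 0, so the
    parity is that of \<open>A 2\<close>.\<close>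
  also have "\<dots> = (\<Sum>d \<in> {2}. int (d - 1) * A d)"
  proof (intro sum.mono_neutral_right ballI)
    fix i assume "i \<in> {1..N} - {2}"
    then have "i = 1 \<or> 3 \<le> i" by auto
    then show "int (i - 1) * A i = 0" using A0 by auto
  qed (use N(1) in auto)
  \<comment> \<open>\<open>f 2 - f 1 = 2 * A 2\<close> lies in {-2, 0, 2}, so \<open>A 2\<close> is
    even only if it is 0.\<close>
  also have "even \<dots> \<longleftrightarrow> f 1 = f 2"
    using f1 f2 f02[of 1] f02[of 2] by auto
  finally show "even (\<Sum>c \<in> I. u c * of_bool (\<not> evenperm (p c))) \<longleftrightarrow> f 1 = f 2" .
qed

section \<open>Finite group actions and conjugacy classes of subgroups\<close>

text \<open>The locale asks for a homomorphism into the group of bijections of E. Bijectivity comes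
  from the action of the inverse; extensionality is part of membership in
  \<open>Bij E\<close>.\<close>

lemma group_actionI:
  fixes G (structure)
  assumes "group G"
    and ext: "\<And>g. g \<in> carrier G \<Longrightarrow> \<phi> g \<in> extensional E"
    and closed: "\<And>g x. g \<in> carrier G \<Longrightarrow> x \<in> E \<Longrightarrow> \<phi> g x \<in> E"
    and one: "\<And>x. x \<in> E \<Longrightarrow> \<phi> \<one>\<^bsub>G\<^esub> x = x"
    and mult: "\<And>g h x. g \<in> carrier G \<Longrightarrow> h \<in> carrier G \<Longrightarrow> x \<in> E \<Longrightarrow> \<phi> (g \<otimes>\<^bsub>G\<^esub> h) x = \<phi> g (\<phi> h x)"
  shows "group_action G E \<phi>"
proof -
  interpret group G by fact
  have bij: "bij_betw (\<phi> g) E E" if "g \<in> carrier G" for g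
  proof (rule bij_betw_byWitness[where f' = "\<phi> (inv g)"])
    show "\<forall>x \<in> E. \<phi> (inv g) (\<phi> g x) = x" "\<forall>x \<in> E. \<phi> g (\<phi> (inv g) x) = x"
      using that by (simp_all add: mult[symmetric] one)
  qed (use that closed in auto)
  have Bij: "\<phi> g \<in> Bij E" if "g \<in> carrier G" for g
    using that bij ext by (simp add: Bij_def)
  have "\<phi> (g \<otimes> h) = compose E (\<phi> g) (\<phi> h)" if "g \<in> carrier G" "h \<in> carrier G" for g h
    using that ext mult by (intro extensionalityI[of _ E]) (auto simp: compose_def)
  then have "\<phi> \<in> hom G (BijGroup E)"
    using Bij by (auto simp: hom_def BijGroup_def)
  then show ?thesis
    by (simp add: group_action_def group_hom_def group_hom_axioms_def group_BijGroup is_group)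
qed

context group_action
begin

sublocale group G
  using group_hom group_hom.axioms(1) by blast

lemma action_closed [simp]: "g \<in> carrier G \<Longrightarrow> x \<in> E \<Longrightarrow> \<phi> g x \<in> E"
  using element_image by blast

lemma action_one [simp]: "x \<in> E \<Longrightarrow> \<phi> \<one> x = x"
  using id_eq_one by (metis restrict_apply')

lemma action_mult:
  "g \<in> carrier G \<Longrightarrow> h \<in> carrier G \<Longrightarrow> x \<in> E \<Longrightarrow> \<phi> (g \<otimes> h) x = \<phi> g (\<phi> h x)"
  by (rule composition_rule)

lemma action_inv_left [simp]: "g \<in> carrier G \<Longrightarrow> x \<in> E \<Longrightarrow> \<phi> (inv g) (\<phi> g x) = x"
  by (simp add: action_mult[symmetric])

lemma action_inv_right [simp]: "g \<in> carrier G \<Longrightarrow> x \<in> E \<Longrightarrow> \<phi> g (\<phi> (inv g) x) = x"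
  by (simp add: action_mult[symmetric])

lemma orbit_subset: "x \<in> E \<Longrightarrow> orbit G \<phi> x \<subseteq> E"
  by (auto simp: orbit_def)

lemma orbit_eq: "x \<in> E \<Longrightarrow> y \<in> orbit G \<phi> x \<Longrightarrow> orbit G \<phi> y = orbit G \<phi> x"
  using orbit_sym[of x y] orbit_trans[of x y] orbit_trans[of y x] orbit_subset[of x] orbit_subset[of y]
  by (intro equalityI subsetI) blast+

lemma orbit_in_orbits: "x \<in> E \<Longrightarrow> orbit G \<phi> x \<in> orbits G E \<phi>"
  by (auto simp: orbits_def)

lemma orbits_eq_orbit: "Y \<in> orbits G E \<phi> \<Longrightarrow> x \<in> Y \<Longrightarrow> x \<in> E \<and> Y = orbit G \<phi> x"
proof -
  assume "Y \<in> orbits G E \<phi>" "x \<in> Y"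
  then obtain y where "y \<in> E" "Y = orbit G \<phi> y" "x \<in> orbit G \<phi> y"
    by (auto simp: orbits_def)
  then show ?thesis using orbit_eq[of y x] orbit_subset[of y] by auto
qed

lemma orbits_nonempty: "Y \<in> orbits G E \<phi> \<Longrightarrow> Y \<noteq> {}"
  using orbit_refl by (auto simp: orbits_def)

lemma finite_orbits: "finite E \<Longrightarrow> finite (orbits G E \<phi>)"
  unfolding orbits_def by simp

end

section \<open>Conjugation and conjugacy classes of subgroups\<close>

context group
begin

lemma mem_conjugate:
  assumes "H \<subseteq> carrier G" "g \<in> carrier G"
  shows "x \<in> g <# H #> inv g \<longleftrightarrow> x \<in> carrier G \<and> inv g \<otimes> x \<otimes> g \<in> H"
proof
  assume "x \<in> g <# H #> inv g"
  then obtain h where h: "h \<in> H" "x = g \<otimes> h \<otimes> inv g"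
    by (auto simp: l_coset_def r_coset_def)
  then have "h \<in> carrier G" using assms by auto
  with h assms show "x \<in> carrier G \<and> inv g \<otimes> x \<otimes> g \<in> H"
    using conjugation_is_surj[of "inv g" h] by simp
next
  assume x: "x \<in> carrier G \<and> inv g \<otimes> x \<otimes> g \<in> H"
  then have "x = g \<otimes> (inv g \<otimes> x \<otimes> g) \<otimes> inv g"
    using assms conjugation_is_surj by simp
  with x show "x \<in> g <# H #> inv g"
    by (auto simp: l_coset_def r_coset_def)
qed

lemma conj_action_eq: "subgroup H G \<Longrightarrow> conj_action G g H = g <# H #> inv g"
  by (simp add: conj_action_def)

lemma group_action_conj_action: "group_action G (subgroups_of G) (conj_action G)"
  unfolding conj_action_def by (rule action_by_conjugation_on_subgroups_set)

sublocale conj: group_action G "subgroups_of G" "conj_action G"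
  by (rule group_action_conj_action)

lemma subgroup_class_in_classes: "subgroup H G \<Longrightarrow> subgroup_class G H \<in> subgroup_classes G"
  unfolding subgroup_class_def subgroup_classes_def by (rule conj.orbit_in_orbits) simp

lemma subgroup_class_self: "subgroup H G \<Longrightarrow> H \<in> subgroup_class G H"
  unfolding subgroup_class_def by (rule conj.orbit_refl) simp

lemma subgroup_classesD:
  "C \<in> subgroup_classes G \<Longrightarrow> H \<in> C \<Longrightarrow> subgroup H G \<and> C = subgroup_class G H"
  unfolding subgroup_class_def subgroup_classes_def using conj.orbits_eq_orbit[of C H] by simp

lemma class_rep_in: "C \<in> subgroup_classes G \<Longrightarrow> class_rep C \<in> C"
  unfolding class_rep_def subgroup_classes_def using conj.orbits_nonempty by (metis all_not_in_conv someI_ex)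

lemma subgroup_class_rep: "C \<in> subgroup_classes G \<Longrightarrow> subgroup (class_rep C) G"
  using class_rep_in subgroup_classesD by blast

lemma subgroup_class_class_rep: "C \<in> subgroup_classes G \<Longrightarrow> subgroup_class G (class_rep C) = C"
  using class_rep_in subgroup_classesD by metis

lemma subgroup_class_eq_iff:
  assumes "subgroup H G" "subgroup K G"
  shows "subgroup_class G H = subgroup_class G K \<longleftrightarrow> (\<exists>g \<in> carrier G. H = g <# K #> inv g)"
proof -
  have "subgroup_class G H = subgroup_class G K \<longleftrightarrow> H \<in> subgroup_class G K"
    using assms subgroup_class_self subgroup_classesD subgroup_class_in_classes by metis
  also have "\<dots> \<longleftrightarrow> (\<exists>g \<in> carrier G. H = g <# K #> inv g)"
    using assms by (auto simp: subgroup_class_def orbit_def conj_action_eq)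
  finally show ?thesis .
qed

lemma subgroup_conjugate: "subgroup H G \<Longrightarrow> g \<in> carrier G \<Longrightarrow> subgroup (g <# H #> inv g) G"
  using conj.action_closed[of g H] by (simp add: conj_action_eq)

lemma subgroup_class_conjugate:
  "subgroup H G \<Longrightarrow> g \<in> carrier G \<Longrightarrow> subgroup_class G (g <# H #> inv g) = subgroup_class G H"
  using subgroup_class_eq_iff subgroup_conjugate by blast

lemma card_conjugate:
  assumes "H \<subseteq> carrier G" "g \<in> carrier G"
  shows "card (g <# H #> inv g) = card H"
proof -
  have "g <# H #> inv g = (\<lambda>h. g \<otimes> h \<otimes> inv g) ` H"
    by (auto simp: l_coset_def r_coset_def)
  moreover have "inj_on (\<lambda>h. g \<otimes> h \<otimes> inv g) H"
    using assms by (intro inj_onI) (meson conjugation_is_inj subsetD)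
  ultimately show ?thesis by (simp add: card_image)
qed

lemma normalizer_iff:
  assumes "subgroup K G"
  shows "g \<in> normalizer G K \<longleftrightarrow> g \<in> carrier G \<and> g <# K #> inv g = K"
  using subgroup.subset[OF assms] by (simp add: normalizer_def stabilizer_def)

lemma subgroup_normalizer: "subgroup K G \<Longrightarrow> subgroup (normalizer G K) G"
  using normalizer_imp_subgroup subgroup.subset by blast

end

lemma (in group_action) stabilizer_action:
  assumes "g \<in> carrier G" "x \<in> E"
  shows "stabilizer G \<phi> (\<phi> g x) = g <# stabilizer G \<phi> x #> inv g"
proof (rule Set.set_eqI)
  fix h
  show "h \<in> stabilizer G \<phi> (\<phi> g x) \<longleftrightarrow> h \<in> g <# stabilizer G \<phi> x #> inv g"
  proof (cases "h \<in> carrier G")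
    case True
    have "\<phi> (inv g \<otimes> h \<otimes> g) x = \<phi> (inv g) (\<phi> h (\<phi> g x))"
      using assms True by (simp add: action_mult)
    also have "\<dots> = x \<longleftrightarrow> \<phi> h (\<phi> g x) = \<phi> g x"
      using assms True by (metis action_closed action_inv_left action_inv_right)
    finally show ?thesis
      using assms True stabilizer_subset
      by (simp add: mem_conjugate) (simp add: stabilizer_def)
  next
    case False
    then show ?thesis
      using assms stabilizer_subset by (simp add: mem_conjugate) (simp add: stabilizer_def)
  qed
qed

locale fin_group = group +
  assumes finite_carrier [simp, intro]: "finite (carrier G)"
begin

lemma finite_subgroups: "finite (subgroups_of G)"
  by (rule finite_subset[of _ "Pow (carrier G)"]) (auto dest: subgroup.subset)

lemma finite_subgroup: "subgroup H G \<Longrightarrow> finite H"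
  using finite_subset subgroup.subset finite_carrier by metis

lemma finite_subgroup_classes [simp]: "finite (subgroup_classes G)"
  unfolding subgroup_classes_def by (rule conj.finite_orbits[OF finite_subgroups])

lemma card_subgroup_pos: "subgroup H G \<Longrightarrow> 0 < card H"
  using finite_subgroup subgroup.one_closed card_gt_0_iff by blast

end

section \<open>Marks\<close>

context group
begin

lemma lcosets_iff: "X \<in> lcosets H \<longleftrightarrow> (\<exists>a \<in> carrier G. X = a <# H)"
  by (auto simp: LCOSETS_def)

lemma group_action_coset_action:
  assumes "subgroup H G"
  shows "group_action G (lcosets H) (coset_action G H)"
proof (rule group_actionI)
  have H: "H \<subseteq> carrier G" using assms subgroup.subset by blast
  fix g X assume gX: "g \<in> carrier G" "X \<in> lcosets H"
  then obtain a where a: "a \<in> carrier G" "X = a <# H" by (auto simp: lcosets_iff)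
  show "coset_action G H g X \<in> lcosets H"
    using gX a H by (auto simp: coset_action_def lcosets_iff lcos_m_assoc)
next
  have H: "H \<subseteq> carrier G" using assms subgroup.subset by blast
  fix g h X assume gX: "g \<in> carrier G" "h \<in> carrier G" "X \<in> lcosets H"
  then obtain a where a: "a \<in> carrier G" "X = a <# H" by (auto simp: lcosets_iff)
  then have "h <# X \<in> lcosets H" using gX a H by (auto simp: lcosets_iff lcos_m_assoc)
  moreover have "X \<subseteq> carrier G" using a H l_coset_subset_G by blast
  ultimately show "coset_action G H (g \<otimes> h) X = coset_action G H g (coset_action G H h X)"
    using gX by (simp add: coset_action_def lcos_m_assoc)
next
  fix X assume "X \<in> lcosets H"
  moreover then have "X \<subseteq> carrier G"
    using assms subgroup.lcosets_carrier is_group by blast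
  ultimately show "coset_action G H \<one> X = X"
    by (simp add: coset_action_def lcos_mult_one)
qed (auto simp: is_group coset_action_def)

lemma subgroup_in_lcosets: "subgroup H G \<Longrightarrow> H \<in> lcosets H"
  using lcos_mult_one[of H] subgroup.subset by (force simp: lcosets_iff)

lemma lcoset_eq_iff:
  assumes "subgroup H G" "a \<in> carrier G" "b \<in> carrier G"
  shows "a <# H = b <# H \<longleftrightarrow> inv b \<otimes> a \<in> H"
proof
  assume "a <# H = b <# H"
  then have "a \<in> b <# H" using lcos_self assms by blast
  then show "inv b \<otimes> a \<in> H"
    using subgroup.lcos_module_imp[OF assms(1) is_group] assms by blast
next
  assume "inv b \<otimes> a \<in> H"
  then have "a \<in> b <# H"
    using subgroup.lcos_module_rev[OF assms(1) is_group] assms by blast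
  then show "a <# H = b <# H"
    using l_repr_independence assms by metis
qed

lemma coset_action_coset:
  assumes "subgroup H G" "g \<in> carrier G" "a \<in> carrier G"
  shows "coset_action G H g (a <# H) = (g \<otimes> a) <# H"
  using assms by (auto simp: coset_action_def lcosets_iff lcos_m_assoc subgroup.subset)

lemma stabilizer_coset_action:
  assumes "subgroup H G" "a \<in> carrier G"
  shows "stabilizer G (coset_action G H) (a <# H) = a <# H #> inv a"
proof (rule Set.set_eqI)
  fix g
  show "g \<in> stabilizer G (coset_action G H) (a <# H) \<longleftrightarrow> g \<in> a <# H #> inv a"
  proof (cases "g \<in> carrier G")
    case True
    then show ?thesis
      using assms lcoset_eq_iff[of H "g \<otimes> a" a]
      by (simp add: stabilizer_def mem_conjugate subgroup.subset coset_action_coset m_assoc)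
  qed (use assms in \<open>simp add: stabilizer_def mem_conjugate subgroup.subset\<close>)
qed

lemma orbit_coset_action:
  assumes "subgroup H G"
  shows "orbit G (coset_action G H) H = lcosets H"
proof -
  have "coset_action G H g H = g <# H" if "g \<in> carrier G" for g
    using subgroup_in_lcosets[OF assms] by (simp add: coset_action_def)
  then show ?thesis unfolding orbit_def LCOSETS_def by force
qed

end

abbreviation coset_mark :: "('a, 'b) monoid_scheme \<Rightarrow> 'a set \<Rightarrow> 'a set \<Rightarrow> nat" where
  "coset_mark G K H \<equiv> card (fixed_points (lcosets\<^bsub>G\<^esub> H) (coset_action G H) K)"

section \<open>Orbits as coset spaces, and fixed points as marks\<close>

context group_action
begin

text \<open>Sending y to the set \<open>T y\<close> of elements carrying x to y identifies the orbit
  with the left cosets of the stabilizer, compatibly with the actions; so K-fixed points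
  correspond.\<close>

lemma card_fixed_orbit:
  assumes x: "x \<in> E" and K: "K \<subseteq> carrier G"
  shows "card (fixed_points (orbit G \<phi> x) \<phi> K) = coset_mark G K (stabilizer G \<phi> x)"
proof -
  let ?H = "stabilizer G \<phi> x"
  have H: "subgroup ?H G" by (rule stabilizer_subgroup[OF x])
  define T where "T y = {g \<in> carrier G. \<phi> g x = y}" for y
  have T: "T (\<phi> a x) = a <# ?H" if a: "a \<in> carrier G" for a
  proof (rule Set.set_eqI)
    fix g
    show "g \<in> T (\<phi> a x) \<longleftrightarrow> g \<in> a <# ?H"
    proof (cases "g \<in> carrier G")
      case True
      have "g \<in> a <# ?H \<longleftrightarrow> inv a \<otimes> g \<in> ?H"
        using subgroup.lcos_module_imp[OF H is_group a] subgroup.lcos_module_rev[OF H is_group a] True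
        by blast
      also have "\<dots> \<longleftrightarrow> \<phi> (inv a) (\<phi> g x) = x"
        using True a x by (simp add: stabilizer_def action_mult)
      also have "\<dots> \<longleftrightarrow> \<phi> g x = \<phi> a x"
        using True a x by (metis action_closed action_inv_left action_inv_right)
      finally show ?thesis using True by (simp add: T_def)
    next
      case False
      then show ?thesis
        using l_coset_subset_G[OF subgroup.subset[OF H] a] by (auto simp: T_def)
    qed
  qed
  have inj: "inj_on T (orbit G \<phi> x)"
  proof (rule inj_onI)
    fix y z assume "y \<in> orbit G \<phi> x" "z \<in> orbit G \<phi> x" "T y = T z"
    then obtain g where "g \<in> T y" "g \<in> T z" by (auto simp: orbit_def T_def)
    then show "y = z" by (simp add: T_def)
  qed
  have "T ` fixed_points (orbit G \<phi> x) \<phi> K = fixed_points (lcosets ?H) (coset_action G ?H) K"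
  proof -
    have *: "\<phi> k (\<phi> a x) = \<phi> a x \<longleftrightarrow> coset_action G ?H k (a <# ?H) = a <# ?H"
      if "a \<in> carrier G" "k \<in> K" for a k
    proof -
      have k: "k \<in> carrier G" using that K by auto
      have "T (\<phi> (k \<otimes> a) x) = coset_action G ?H k (a <# ?H)"
        using that k H by (simp add: T coset_action_coset)
      moreover have "\<phi> (k \<otimes> a) x = \<phi> k (\<phi> a x)"
        using that k x by (simp add: action_mult)
      moreover have "\<phi> (k \<otimes> a) x \<in> orbit G \<phi> x" "\<phi> a x \<in> orbit G \<phi> x"
        using that k by (auto simp: orbit_def)
      ultimately show ?thesis
        using inj T[OF that(1)] by (metis inj_onD)
    qed
    show ?thesis
    proof (intro equalityI subsetI)
      fix X assume "X \<in> T ` fixed_points (orbit G \<phi> x) \<phi> K"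
      then obtain a where "a \<in> carrier G" "X = T (\<phi> a x)" "\<forall>k \<in> K. \<phi> k (\<phi> a x) = \<phi> a x"
        by (auto simp: fixed_points_def orbit_def)
      then show "X \<in> fixed_points (lcosets ?H) (coset_action G ?H) K"
        using * T by (auto simp: fixed_points_def lcosets_iff)
    next
      fix X assume "X \<in> fixed_points (lcosets ?H) (coset_action G ?H) K"
      then obtain a where a: "a \<in> carrier G" "X = a <# ?H"
        and "\<forall>k \<in> K. coset_action G ?H k (a <# ?H) = a <# ?H"
        by (auto simp: fixed_points_def lcosets_iff)
      then have "\<phi> a x \<in> fixed_points (orbit G \<phi> x) \<phi> K"
        using * by (auto simp: fixed_points_def orbit_def)
      then show "X \<in> T ` fixed_points (orbit G \<phi> x) \<phi> K"
        using T[OF a(1)] a(2) by blast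
    qed
  qed
  moreover have "fixed_points (orbit G \<phi> x) \<phi> K \<subseteq> orbit G \<phi> x"
    by (auto simp: fixed_points_def)
  ultimately show ?thesis
    using card_image[OF inj_on_subset[OF inj]] by metis
qed

text \<open>A conjugate of the stabilizer is the stabilizer of another point of the same orbit, so
  moving the base point realises any representative of the class.\<close>

lemma card_fixed_orbit_class:
  assumes x: "x \<in> E" and K: "K \<subseteq> carrier G" and H: "H \<in> subgroup_class G (stabilizer G \<phi> x)"
  shows "card (fixed_points (orbit G \<phi> x) \<phi> K) = coset_mark G K H"
proof -
  obtain g where g: "g \<in> carrier G" "H = g <# stabilizer G \<phi> x #> inv g"
    using H stabilizer_subgroup[OF x] by (auto simp: subgroup_class_def orbit_def conj_action_eq)
  then have "orbit G \<phi> (\<phi> g x) = orbit G \<phi> x"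
    using x by (intro orbit_eq) (auto simp: orbit_def)
  then show ?thesis
    using card_fixed_orbit[of "\<phi> g x" K] g x K by (simp add: stabilizer_action)
qed

lemma fixed_points_conjugate:
  assumes g: "g \<in> carrier G" and K: "K \<subseteq> carrier G"
  shows "fixed_points E \<phi> (g <# K #> inv g) = \<phi> g ` fixed_points E \<phi> K"
proof
  have *: "\<phi> (g \<otimes> k \<otimes> inv g) (\<phi> g x) = \<phi> g (\<phi> k x)" if "k \<in> K" "x \<in> E" for k x
    using that g K by (simp add: action_mult subset_iff)
  show "\<phi> g ` fixed_points E \<phi> K \<subseteq> fixed_points E \<phi> (g <# K #> inv g)"
    using g by (auto simp: fixed_points_def l_coset_def r_coset_def *)
  show "fixed_points E \<phi> (g <# K #> inv g) \<subseteq> \<phi> g ` fixed_points E \<phi> K"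
  proof
    fix y assume y: "y \<in> fixed_points E \<phi> (g <# K #> inv g)"
    then have E: "y \<in> E" "\<phi> (inv g) y \<in> E" using g by (auto simp: fixed_points_def)
    have "\<phi> k (\<phi> (inv g) y) = \<phi> (inv g) y" if "k \<in> K" for k
    proof -
      have "g \<otimes> k \<otimes> inv g \<in> g <# K #> inv g"
        using that by (auto simp: l_coset_def r_coset_def)
      then have "\<phi> (g \<otimes> k \<otimes> inv g) y = y" using y by (auto simp: fixed_points_def)
      then have "\<phi> g (\<phi> k (\<phi> (inv g) y)) = y" using *[OF that E(2)] E g by simp
      then show ?thesis using E g K that by (metis action_closed action_inv_left subsetD)
    qed
    then show "y \<in> \<phi> g ` fixed_points E \<phi> K"
      using E g by (intro image_eqI[of _ _ "\<phi> (inv g) y"]) (auto simp: fixed_points_def)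
  qed
qed

lemma card_fixed_points_conjugate:
  assumes "g \<in> carrier G" "K \<subseteq> carrier G"
  shows "card (fixed_points E \<phi> (g <# K #> inv g)) = card (fixed_points E \<phi> K)"
  unfolding fixed_points_conjugate[OF assms]
  by (rule card_image, rule inj_on_subset[OF inj_prop[OF assms(1)]]) (auto simp: fixed_points_def)

lemma card_fixed_points_orbits:
  assumes "finite E"
  shows "card (fixed_points E \<phi> K) = (\<Sum>Y \<in> orbits G E \<phi>. card (fixed_points Y \<phi> K))"
proof -
  have *: "card (fixed_points A \<phi> K) = (\<Sum>x \<in> A. if \<forall>k \<in> K. \<phi> k x = x then 1 else 0)" if "finite A" for A
    using that by (simp add: fixed_points_def sum.If_cases Int_def)
  have "finite Y" if "Y \<in> orbits G E \<phi>" for Y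
    using that finite_subset[OF orbit_subset assms] by (auto simp: orbits_def)
  then have "(\<Sum>Y \<in> orbits G E \<phi>. card (fixed_points Y \<phi> K))
      = (\<Sum>Y \<in> orbits G E \<phi>. \<Sum>x \<in> Y. if \<forall>k \<in> K. \<phi> k x = x then 1 else 0)"
    by (intro sum.cong refl *) auto
  then show ?thesis
    using *[OF assms] disjoint_sum[OF assms, of "\<lambda>x. if \<forall>k \<in> K. \<phi> k x = x then 1 else 0 :: nat"] by simp
qed

end

text \<open>Splitting E into orbits and grouping them by stabilizer class turns the count of fixed
  points into the formula for \<open>mark\<close>. This ties the formal coordinates to actual G-sets
  and is what later makes marks multiplicative.\<close>

lemma (in group_action) mark_gset_class:
  assumes "finite (carrier G)" "finite E" and K: "K \<subseteq> carrier G"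
  shows "mark G K (gset_class G E \<phi> :: 'a set set \<Rightarrow> 'r :: comm_ring_1) = of_nat (card (fixed_points E \<phi> K))"
proof -
  interpret fin_group G by unfold_locales fact
  \<comment> \<open>The choice of the point is immaterial, as stabilizers along an orbit are
    conjugate.\<close>
  define cl where "cl Y = subgroup_class G (stabilizer G \<phi> (SOME x. x \<in> Y))" for Y
  have cl: "cl Y = subgroup_class G (stabilizer G \<phi> x)" if Y: "Y \<in> orbits G E \<phi>" "x \<in> Y" for x Y
  proof -
    let ?y = "SOME x. x \<in> Y"
    have "?y \<in> Y" using Y someI by metis
    then have "?y \<in> orbit G \<phi> x" "x \<in> E" using orbits_eq_orbit[OF Y] by auto
    then obtain g where "g \<in> carrier G" "?y = \<phi> g x" "x \<in> E" by (auto simp: orbit_def)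
    then show ?thesis
      by (simp add: cl_def stabilizer_action subgroup_class_conjugate stabilizer_subgroup)
  qed
  have types: "{Y \<in> orbits G E \<phi>. \<exists>x \<in> Y. stabilizer G \<phi> x \<in> C} = {Y \<in> orbits G E \<phi>. cl Y = C}"
    if "C \<in> subgroup_classes G" for C
  proof -
    have "(\<exists>x \<in> Y. stabilizer G \<phi> x \<in> C) \<longleftrightarrow> cl Y = C" if Y: "Y \<in> orbits G E \<phi>" for Y
    proof
      assume "\<exists>x \<in> Y. stabilizer G \<phi> x \<in> C"
      then show "cl Y = C" using cl[OF Y] subgroup_classesD[OF \<open>C \<in> subgroup_classes G\<close>] by metis
    next
      assume "cl Y = C"
      obtain x where x: "x \<in> Y" using orbits_nonempty[OF Y] by blast
      then have "x \<in> E" using orbits_eq_orbit[OF Y] by blast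
      then have "stabilizer G \<phi> x \<in> subgroup_class G (stabilizer G \<phi> x)"
        using stabilizer_subgroup subgroup_class_self by blast
      then show "\<exists>x \<in> Y. stabilizer G \<phi> x \<in> C" using cl[OF Y x] x \<open>cl Y = C\<close> by auto
    qed
    then show ?thesis by blast
  qed
  have cl_in: "cl ` orbits G E \<phi> \<subseteq> subgroup_classes G"
  proof
    fix C assume "C \<in> cl ` orbits G E \<phi>"
    then obtain Y where Y: "Y \<in> orbits G E \<phi>" "C = cl Y" by blast
    obtain x where x: "x \<in> Y" using orbits_nonempty[OF Y(1)] by blast
    then have "x \<in> E" using orbits_eq_orbit[OF Y(1)] by blast
    then show "C \<in> subgroup_classes G"
      using cl[OF Y(1) x] Y(2) stabilizer_subgroup subgroup_class_in_classes by metis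
  qed
  have fixed: "card (fixed_points Y \<phi> K) = coset_mark G K (class_rep (cl Y))" if Y: "Y \<in> orbits G E \<phi>" for Y
  proof -
    obtain x where x: "x \<in> Y" using orbits_nonempty[OF Y] by blast
    have "cl Y \<in> subgroup_classes G" using Y cl_in by blast
    then have "class_rep (cl Y) \<in> subgroup_class G (stabilizer G \<phi> x)"
      using class_rep_in cl[OF Y x] by metis
    then show ?thesis
      using card_fixed_orbit_class[of x K] orbits_eq_orbit[OF Y x] K by metis
  qed
  have "card (fixed_points E \<phi> K) = (\<Sum>Y \<in> orbits G E \<phi>. coset_mark G K (class_rep (cl Y)))"
    using card_fixed_points_orbits[OF \<open>finite E\<close>] fixed by simp
  also have "\<dots> = (\<Sum>C \<in> subgroup_classes G. \<Sum>Y \<in> {Y \<in> orbits G E \<phi>. cl Y = C}. coset_mark G K (class_rep (cl Y)))"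
    using finite_orbits[OF \<open>finite E\<close>] cl_in by (intro sum.group[symmetric]) auto
  also have "\<dots> = (\<Sum>C \<in> subgroup_classes G. card {Y \<in> orbits G E \<phi>. cl Y = C} * coset_mark G K (class_rep C))"
    by simp
  finally show ?thesis
    by (simp add: mark_def gset_class_def types)
qed

section \<open>Weyl groups, their action on fixed points, and the Burnside congruence\<close>

context group
begin

lemma normal_in_normalizer:
  "subgroup K G \<Longrightarrow> K \<lhd> G\<lparr>carrier := normalizer G K\<rparr>"
  using subgroup_in_normalizer .

lemma group_weyl_group: "subgroup K G \<Longrightarrow> group (weyl_group G K)"
  unfolding weyl_group_def using normal_in_normalizer normal.factorgroup_is_group by blast

lemma carrier_weyl_group: "carrier (weyl_group G K) = (\<lambda>g. K #> g) ` normalizer G K"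
  by (auto simp: weyl_group_def FactGroup_def RCOSETS_def)

lemma one_weyl_group [simp]: "\<one>\<^bsub>weyl_group G K\<^esub> = K"
  by (simp add: weyl_group_def)

lemma normalizer_subset: "subgroup K G \<Longrightarrow> normalizer G K \<subseteq> carrier G"
  using subgroup_normalizer subgroup.subset by blast

lemma mult_weyl_group:
  assumes "subgroup K G" "g \<in> normalizer G K" "h \<in> normalizer G K"
  shows "(K #> g) \<otimes>\<^bsub>weyl_group G K\<^esub> (K #> h) = K #> (g \<otimes> h)"
  using normal.rcos_sum[OF normal_in_normalizer[OF assms(1)]] assms(2,3)
  by (simp add: weyl_group_def)

lemma subgroup_subset_normalizer: "subgroup K G \<Longrightarrow> K \<subseteq> normalizer G K"
  using normal_imp_subgroup[OF normal_in_normalizer] subgroup.subset by fastforce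

lemma generate_subgroup: "subgroup K G \<Longrightarrow> generate G K = K"
  using generateI[of K K] by simp

end

lemma (in group_action) fixed_points_generate:
  assumes "S \<subseteq> carrier G"
  shows "fixed_points E \<phi> (generate G S) = fixed_points E \<phi> S"
proof -
  have "generate G S \<subseteq> stabilizer G \<phi> x" if "x \<in> E" "\<forall>k \<in> S. \<phi> k x = x" for x
    using that assms
    by (intro generate_subgroup_incl[OF _ stabilizer_subgroup]) (auto simp: stabilizer_def)
  then show ?thesis
    by (auto simp: fixed_points_def stabilizer_def intro: generate.incl)
qed

text \<open>K acts trivially here, so this is the action of W_G(K) inflated to the normalizer; in
  this form elements can be used in place of cosets.\<close>

lemma (in group_action) normalizer_acts_on_fixed_points:
  assumes K: "subgroup K G"
  shows "group_action (G\<lparr>carrier := normalizer G K\<rparr>) (fixed_points E \<phi> K)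
    (\<lambda>g. restrict (\<phi> g) (fixed_points E \<phi> K))"
proof -
  let ?F = "fixed_points E \<phi> K"
  have N: "normalizer G K \<subseteq> carrier G" by (rule normalizer_subset[OF K])
  have FE: "x \<in> E" if "x \<in> ?F" for x using that by (simp add: fixed_points_def)
  have closed: "\<phi> g x \<in> ?F" if "g \<in> normalizer G K" "x \<in> ?F" for g x
  proof -
    have g: "g \<in> carrier G" "g <# K #> inv g = K" using that normalizer_iff[OF K] by auto
    have "\<phi> k (\<phi> g x) = \<phi> g x" if k: "k \<in> K" for k
    proof -
      have "inv g \<otimes> k \<otimes> g \<in> K" and kG: "k \<in> carrier G"
        using k g mem_conjugate[OF subgroup.subset[OF K] g(1), of k] by auto
      then have "\<phi> (inv g \<otimes> k \<otimes> g) x = x"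
        using \<open>x \<in> ?F\<close> by (simp add: fixed_points_def)
      then have "\<phi> (inv g) (\<phi> k (\<phi> g x)) = x"
        using g kG FE[OF \<open>x \<in> ?F\<close>] by (simp add: action_mult)
      then show ?thesis
        using g kG FE[OF \<open>x \<in> ?F\<close>] by (metis action_closed action_inv_right)
    qed
    then show ?thesis using g FE[OF \<open>x \<in> ?F\<close>] by (simp add: fixed_points_def)
  qed
  show ?thesis
  proof (rule group_actionI)
    show "group (G\<lparr>carrier := normalizer G K\<rparr>)"
      using subgroup_normalizer[OF K] subgroup_imp_group by blast
  qed (use closed N FE in \<open>auto simp: action_mult subset_iff\<close>)
qed

text \<open>The fibres of g \<mapsto> Kg all have |K| elements, so orbit counting over the
  normalizer can be rewritten over W_G(K).\<close>

lemma (in fin_group) sum_normalizer_cosets: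
  fixes h :: "'a set \<Rightarrow> nat"
  assumes K: "subgroup K G"
  shows "(\<Sum>g \<in> normalizer G K. h (K #> g)) = card K * (\<Sum>X \<in> carrier (weyl_group G K). h X)"
proof -
  have N: "normalizer G K \<subseteq> carrier G" by (rule normalizer_subset[OF K])
  have fin: "finite (normalizer G K)" using N finite_carrier finite_subset by blast
  have card: "card {g \<in> normalizer G K. K #> g = X} = card K" if X: "X \<in> carrier (weyl_group G K)" for X
  proof -
    obtain a where a: "a \<in> normalizer G K" "X = K #> a" using X by (auto simp: carrier_weyl_group)
    \<comment> \<open>A coset, being a set of elements, is its own fibre.\<close>
    have "{g \<in> normalizer G K. K #> g = X} = X"
    proof (intro equalityI subsetI)
      fix g assume "g \<in> {g \<in> normalizer G K. K #> g = X}"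
      then show "g \<in> X" using rcos_self[OF _ K] N by blast
    next
      fix g assume g: "g \<in> X"
      then obtain k where "k \<in> K" "g = k \<otimes> a" using a by (auto simp: r_coset_def)
      then have "g \<in> normalizer G K"
        using a subgroup_subset_normalizer[OF K] subgroup.m_closed[OF subgroup_normalizer[OF K]] by blast
      moreover have "K #> g = X"
        using repr_independence[of g K a] g a N K by auto
      ultimately show "g \<in> {g \<in> normalizer G K. K #> g = X}" by blast
    qed
    moreover have "card X = card K"
      using a N card_rcosets_equal[OF _ subgroup.subset[OF K], of X] by (force simp: RCOSETS_def)
    ultimately show ?thesis by simp
  qed
  have "(\<Sum>g \<in> normalizer G K. h (K #> g))
      = (\<Sum>X \<in> carrier (weyl_group G K). \<Sum>g \<in> {g \<in> normalizer G K. K #> g = X}. h (K #> g))"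
    using fin by (intro sum.group[symmetric]) (auto simp: carrier_weyl_group)
  also have "\<dots> = (\<Sum>X \<in> carrier (weyl_group G K). card K * h X)"
    using card by (intro sum.cong) auto
  finally show ?thesis by (simp add: sum_distrib_left)
qed

text \<open>The count of the orbits of \<open>W\<^sub>G(K)\<close> on the \<open>K\<close>-fixed points gives the Burnside congruence.\<close>

lemma (in group_action) weyl_burnside:
  assumes fin: "finite (carrier G)" "finite E" and K: "subgroup K G"
  shows "card (carrier (weyl_group G K)) dvd
    (\<Sum>X \<in> carrier (weyl_group G K). card (fixed_points E \<phi> (generate G (K \<union> X))))"
proof -
  interpret fin_group G by unfold_locales fact
  let ?N = "normalizer G K" and ?F = "fixed_points E \<phi> K" and ?W = "carrier (weyl_group G K)"
  define \<psi> where "\<psi> g = restrict (\<phi> g) ?F" for g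
  interpret N: group_action "G\<lparr>carrier := ?N\<rparr>" ?F \<psi>
    unfolding \<psi>_def by (rule normalizer_acts_on_fixed_points[OF K])
  have N: "?N \<subseteq> carrier G" by (rule normalizer_subset[OF K])
  have inv: "invariants ?F \<psi> g = fixed_points E \<phi> (generate G (K \<union> (K #> g)))" if "g \<in> ?N" for g
  proof -
    have g: "g \<in> carrier G" using that N by blast
    have "fixed_points E \<phi> (generate G (K \<union> (K #> g))) = fixed_points E \<phi> (insert g K)"
      using fixed_points_generate[of "insert g K"] g subgroup.subset[OF K] by (simp add: generate_Un_coset[OF K g])
    then show ?thesis by (auto simp: invariants_def \<psi>_def fixed_points_def)
  qed
  define n where "n = card (orbits (G\<lparr>carrier := ?N\<rparr>) ?F \<psi>)"
  \<comment> \<open>Orbit counting makes the sum over the normalizer a multiple of its order;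
    cancelling |K| on both sides leaves a multiple of |W_G(K)|.\<close>
  have "n * order (G\<lparr>carrier := ?N\<rparr>) = (\<Sum>g \<in> ?N. card (fixed_points E \<phi> (generate G (K \<union> (K #> g)))))"
    using N.burnside finite_subset[OF N fin(1)] finite_subset[of ?F E] fin(2) inv
    by (simp add: n_def) (simp add: fixed_points_def)
  also have "\<dots> = card K * (\<Sum>X \<in> ?W. card (fixed_points E \<phi> (generate G (K \<union> X))))"
    by (rule sum_normalizer_cosets[OF K])
  finally have "n * card ?N = card K * (\<Sum>X \<in> ?W. card (fixed_points E \<phi> (generate G (K \<union> X))))"
    by (simp add: order_def)
  moreover have "card ?N = card K * card ?W"
    using sum_normalizer_cosets[OF K, of "\<lambda>_. 1"] by simp
  ultimately have "(\<Sum>X \<in> ?W. card (fixed_points E \<phi> (generate G (K \<union> X)))) = n * card ?W"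
    using card_subgroup_pos[OF K] by simp
  then show ?thesis by simp
qed

section \<open>The triangular table of marks and elements with prescribed marks\<close>

context fin_group
begin

lemma finite_lcosets: "finite (lcosets H)"
  by (simp add: LCOSETS_def)

lemma coset_mark_conjugate:
  assumes "subgroup H G" "subgroup K G" "g \<in> carrier G"
  shows "coset_mark G (g <# K #> inv g) H = coset_mark G K H"
proof -
  interpret group_action G "lcosets H" "coset_action G H"
    by (rule group_action_coset_action) fact
  show ?thesis
    using assms by (intro card_fixed_points_conjugate) (auto dest: subgroup.subset)
qed

lemma coset_mark_class:
  assumes "subgroup H G" "subgroup K G" "H' \<in> subgroup_class G H"
  shows "coset_mark G K H' = coset_mark G K H"
proof -
  interpret group_action G "lcosets H" "coset_action G H"
    by (rule group_action_coset_action) fact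
  have "stabilizer G (coset_action G H) H = H"
    using stabilizer_coset_action[OF assms(1) one_closed] subgroup.subset[OF assms(1)]
    by (simp add: lcos_mult_one)
  then show ?thesis
    using card_fixed_orbit_class[OF subgroup_in_lcosets[OF assms(1)], of K H'] assms
    by (simp add: orbit_coset_action subgroup.subset)
qed

lemma mark_class:
  fixes u :: "'a set set \<Rightarrow> 'r :: comm_ring_1"
  assumes "subgroup K G" "subgroup L G" "subgroup_class G K = subgroup_class G L"
  shows "mark G K u = mark G L u"
proof -
  obtain g where g: "g \<in> carrier G" "K = g <# L #> inv g"
    using assms subgroup_class_eq_iff[OF assms(1,2)] by auto
  have "coset_mark G K (class_rep C) = coset_mark G L (class_rep C)" if "C \<in> subgroup_classes G" for C
    unfolding g(2) using coset_mark_conjugate[OF subgroup_class_rep[OF that] assms(2) g(1)] .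
  then show ?thesis by (simp add: mark_def)
qed

text \<open>The coset aH is fixed by K exactly when K lies in aHa^-1. As K is at least as large as
  H, the two would then coincide. This is the triangular shape of the table of marks.\<close>

lemma coset_mark_eq_0:
  assumes H: "subgroup H G" and K: "subgroup K G" and "card H \<le> card K"
    and "subgroup_class G H \<noteq> subgroup_class G K"
  shows "coset_mark G K H = 0"
proof -
  have "fixed_points (lcosets H) (coset_action G H) K = {}"
  proof (rule ccontr)
    assume "fixed_points (lcosets H) (coset_action G H) K \<noteq> {}"
    then obtain a where a: "a \<in> carrier G" "\<forall>k \<in> K. coset_action G H k (a <# H) = a <# H"
      by (auto simp: fixed_points_def lcosets_iff)
    then have "K \<subseteq> a <# H #> inv a"
      using subgroup.subset[OF K] unfolding stabilizer_coset_action[OF H a(1), symmetric]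
      by (auto simp: stabilizer_def)
    moreover have "card (a <# H #> inv a) = card H"
      using a H by (simp add: card_conjugate subgroup.subset)
    ultimately have "K = a <# H #> inv a"
      using \<open>card H \<le> card K\<close> finite_subgroup[OF subgroup_conjugate[OF H a(1)]] by (intro card_seteq) auto
    then show False using assms(4) subgroup_class_conjugate[OF H a(1)] by simp
  qed
  then show ?thesis by simp
qed

text \<open>The coset aK is K-fixed exactly when a normalizes K, and then aK = Ka. So the fixed left
  cosets are literally the right cosets that make up W_G(K).\<close>

lemma coset_mark_self:
  assumes K: "subgroup K G"
  shows "coset_mark G K K = card (carrier (weyl_group G K))"
proof -
  have "fixed_points (lcosets K) (coset_action G K) K = carrier (weyl_group G K)"
  proof -
    have eq: "(\<forall>k \<in> K. coset_action G K k (a <# K) = a <# K) \<longleftrightarrow> a \<in> normalizer G K"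
      if a: "a \<in> carrier G" for a
    proof -
      have "(\<forall>k \<in> K. coset_action G K k (a <# K) = a <# K) \<longleftrightarrow> K \<subseteq> a <# K #> inv a"
        using subgroup.subset[OF K] unfolding stabilizer_coset_action[OF K a, symmetric]
        by (auto simp: stabilizer_def)
      also have "\<dots> \<longleftrightarrow> a <# K #> inv a = K"
        using card_conjugate[OF subgroup.subset[OF K] a] finite_subgroup[OF subgroup_conjugate[OF K a]]
          card_seteq[of "a <# K #> inv a" K] by auto
      finally show ?thesis using a by (simp add: normalizer_iff[OF K])
    qed
    have "a <# K = K #> a" if "a \<in> normalizer G K" for a
    proof -
      have a: "a \<in> carrier G" "a <# K #> inv a = K" using that normalizer_iff[OF K] by auto
      then have "K #> a = a <# K #> inv a #> a" by simp
      also have "\<dots> = a <# K"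
        using a(1) subgroup.subset[OF K] by (simp add: coset_mult_assoc l_coset_subset_G)
      finally show ?thesis by simp
    qed
    then have "carrier (weyl_group G K) = (\<lambda>a. a <# K) ` normalizer G K"
      by (auto simp: carrier_weyl_group)
    also have "\<dots> = {a <# K | a. a \<in> carrier G \<and> (\<forall>k \<in> K. coset_action G K k (a <# K) = a <# K)}"
      using eq normalizer_subset[OF K] by blast
    finally show ?thesis by (auto simp: fixed_points_def lcosets_iff)
  qed
  then show ?thesis by simp
qed

lemma weyl_group_finite: "subgroup K G \<Longrightarrow> finite (carrier (weyl_group G K))"
  using finite_subset[OF normalizer_subset finite_carrier] by (simp add: carrier_weyl_group)

lemma card_weyl_group_pos: "subgroup K G \<Longrightarrow> 0 < card (carrier (weyl_group G K))"
  using weyl_group_finite[of K] monoid.one_closed[OF group.is_monoid[OF group_weyl_group]] card_gt_0_iff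
  by blast

text \<open>Larger classes have coefficient 0 by hypothesis, and the remaining ones other than that
  of K have mark 0 at K by triangularity; the diagonal term is left.\<close>

lemma mark_leading_class:
  fixes u :: "'a set set \<Rightarrow> 'r :: comm_ring_1"
  assumes K: "subgroup K G"
    and u: "\<And>C. C \<in> subgroup_classes G \<Longrightarrow> card K < card (class_rep C) \<Longrightarrow> u C = 0"
  shows "mark G K u = u (subgroup_class G K) * of_nat (card (carrier (weyl_group G K)))"
proof -
  have "mark G K u = (\<Sum>C \<in> {subgroup_class G K}. u C * of_nat (coset_mark G K (class_rep C)))"
    unfolding mark_def
  proof (rule sum.mono_neutral_right)
    show "\<forall>C \<in> subgroup_classes G - {subgroup_class G K}. u C * of_nat (coset_mark G K (class_rep C)) = 0"
    proof
      fix C assume C: "C \<in> subgroup_classes G - {subgroup_class G K}"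
      show "u C * of_nat (coset_mark G K (class_rep C)) = 0"
      proof (cases "card K < card (class_rep C)")
        case False
        then have "coset_mark G K (class_rep C) = 0"
          using C K by (intro coset_mark_eq_0) (auto simp: subgroup_class_rep subgroup_class_class_rep)
        then show ?thesis by simp
      qed (use u C in simp)
    qed
  qed (use K subgroup_class_in_classes in auto)
  moreover have "coset_mark G K (class_rep (subgroup_class G K)) = coset_mark G K K"
    using K by (intro coset_mark_class class_rep_in subgroup_class_in_classes)
  ultimately show ?thesis
    using coset_mark_self[OF K] by simp
qed

text \<open>Descending induction on the order: once all larger classes have coefficient 0, the mark
  at \<open>class_rep C\<close> is \<open>u C\<close> times |W_G(K)|, which is nonzero in
  characteristic 0.\<close>

lemma marks_eq_0:
  fixes u :: "'a set set \<Rightarrow> 'r :: {comm_ring_1, ring_char_0, ring_no_zero_divisors}"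
  assumes "\<And>K. subgroup K G \<Longrightarrow> mark G K u = 0" and C: "C \<in> subgroup_classes G"
  shows "u C = 0"
  using C
proof (induction "card (carrier G) - card (class_rep C)" arbitrary: C rule: less_induct)
  case (less C)
  let ?K = "class_rep C"
  have K: "subgroup ?K G" using less.prems by (rule subgroup_class_rep)
  have "u D = 0" if "D \<in> subgroup_classes G" "card ?K < card (class_rep D)" for D
    using that less.hyps[of D] card_mono[OF finite_carrier subgroup.subset[OF subgroup_class_rep[OF that(1)]]]
    by simp
  then have "mark G ?K u = u C * of_nat (card (carrier (weyl_group G ?K)))"
    using mark_leading_class[OF K, of u] less.prems by (simp add: subgroup_class_class_rep)
  then show ?case using assms(1)[OF K] card_weyl_group_pos[OF K] by simp
qed

lemma mark_add: "mark G K (\<lambda>C \<in> subgroup_classes G. u C + v C) = mark G K u + mark G K v"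
  by (simp add: mark_def distrib_right sum.distrib)

lemma mark_diff: "mark G K (\<lambda>C \<in> subgroup_classes G. u C - v C) = mark G K u - mark G K v"
  by (simp add: mark_def left_diff_distrib sum_subtractf)

lemma marks_inject:
  fixes u v :: "'a set set \<Rightarrow> 'r :: {comm_ring_1, ring_char_0, ring_no_zero_divisors}"
  assumes "u \<in> carrier (burnside_ring G)" "v \<in> carrier (burnside_ring G)"
    and "\<And>K. subgroup K G \<Longrightarrow> mark G K u = mark G K v"
  shows "u = v"
proof (rule extensionalityI[of _ "subgroup_classes G"])
  fix C assume C: "C \<in> subgroup_classes G"
  have "(\<lambda>C \<in> subgroup_classes G. u C - v C) C = 0"
  proof (rule marks_eq_0[OF _ C])
    show "mark G K (\<lambda>C \<in> subgroup_classes G. u C - v C) = 0" if "subgroup K G" for K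
      unfolding mark_diff using assms(3)[OF that] by simp
  qed
  then show "u C = v C" using C by simp
qed (use assms in \<open>auto simp: burnside_ring_def PiE_def\<close>)

text \<open>The table of marks is triangular, so marks can be prescribed by descending order of the
  subgroups as soon as each leading coefficient is divisible by the diagonal entry \<open>|W\<^sub>G(K)|\<close>.\<close>

lemma exists_marks:
  fixes f :: "'a set \<Rightarrow> 'r :: comm_ring_1" and r :: "'a set set \<Rightarrow> 'a set"
  assumes r: "\<And>C. C \<in> subgroup_classes G \<Longrightarrow> r C \<in> C"
    and P_diff: "\<And>f u. P f \<Longrightarrow> P (\<lambda>K. f K - mark G K (u :: 'a set set \<Rightarrow> 'r))"
    and leading: "\<And>f C. P f \<Longrightarrow> C \<in> subgroup_classes G
      \<Longrightarrow> (\<And>L. subgroup L G \<Longrightarrow> card (r C) < card L \<Longrightarrow> f L = 0)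
      \<Longrightarrow> \<exists>c. f (r C) = c * of_nat (card (carrier (weyl_group G (r C))))"
    and "P f"
    and "\<And>K L. subgroup K G \<Longrightarrow> subgroup L G \<Longrightarrow> subgroup_class G K = subgroup_class G L \<Longrightarrow> f K = f L"
  shows "\<exists>u \<in> carrier (burnside_ring G). \<forall>K. subgroup K G \<longrightarrow> mark G K u = f K"
proof -
  \<comment> \<open>Elimination from the largest subgroups downwards: \<open>n\<close> bounds the
    orders at which f may still be nonzero. \<open>P\<close> survives subtracting marks, so it
    passes on to each remainder.\<close>
  have "\<exists>u \<in> carrier (burnside_ring G). \<forall>K. subgroup K G \<longrightarrow> mark G K u = f K"
    if "P f" and "\<And>K L. subgroup K G \<Longrightarrow> subgroup L G \<Longrightarrow> subgroup_class G K = subgroup_class G L \<Longrightarrow> f K = f L"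
      and "\<And>L. subgroup L G \<Longrightarrow> n < card L \<Longrightarrow> f L = 0" for n and f :: "'a set \<Rightarrow> 'r"
    using that
  proof (induction n arbitrary: f)
    case 0
    then have "f K = 0" if "subgroup K G" for K
      using that card_subgroup_pos by blast
    then show ?case
      by (intro bexI[of _ "\<lambda>C \<in> subgroup_classes G. 0"]) (auto simp: mark_def burnside_ring_def)
  next
    case (Suc n)
    have rC: "subgroup (r C) G" "subgroup_class G (r C) = C" if "C \<in> subgroup_classes G" for C
      using that r subgroup_classesD by metis+
    have "\<exists>c. f (r C) = c * of_nat (card (carrier (weyl_group G (r C))))"
      if "C \<in> subgroup_classes G" "card (r C) = Suc n" for C
      using leading[OF Suc.prems(1) that(1)] Suc.prems(3) that(2) by simp
    then obtain c where c: "\<And>C. C \<in> subgroup_classes G \<Longrightarrow> card (r C) = Suc n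
        \<Longrightarrow> f (r C) = c C * of_nat (card (carrier (weyl_group G (r C))))"
      by metis
    \<comment> \<open>All classes of order \<open>Suc n\<close> are cleared at once, since
      nonconjugate subgroups of equal order have mark 0 on each other.\<close>
    define u where "u = (\<lambda>C \<in> subgroup_classes G. if card (r C) = Suc n then c C else 0)"
    have card_r: "card (class_rep C) = card (r C)" if C: "C \<in> subgroup_classes G" for C
    proof -
      obtain g where "g \<in> carrier G" "class_rep C = g <# r C #> inv g"
        using subgroup_class_eq_iff[OF subgroup_class_rep[OF C] rC(1)[OF C]]
          subgroup_class_class_rep[OF C] rC(2)[OF C] by auto
      then show ?thesis using card_conjugate subgroup.subset[OF rC(1)[OF C]] by simp
    qed
    have u: "mark G L u = f L" if L: "subgroup L G" "n < card L" for L
    proof -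
      let ?C = "subgroup_class G L"
      have C: "?C \<in> subgroup_classes G" using L subgroup_class_in_classes by blast
      obtain g where g: "g \<in> carrier G" "L = g <# r ?C #> inv g"
        using subgroup_class_eq_iff[OF L(1) rC(1)[OF C]] rC(2)[OF C] by auto
      have card_L: "card (r ?C) = card L"
        using card_conjugate[OF subgroup.subset[OF rC(1)[OF C]] g(1)] unfolding g(2)[symmetric] by simp
      have "mark G L u = mark G (r ?C) u"
        using L(1) rC[OF C] by (intro mark_class) auto
      also have "\<dots> = u ?C * of_nat (card (carrier (weyl_group G (r ?C))))"
        using mark_leading_class[OF rC(1)[OF C], of u] rC(2)[OF C] card_r card_L L(2) by (auto simp: u_def)
      also have "\<dots> = f (r ?C)"
        using c[OF C] C Suc.prems(3)[OF rC(1)[OF C]] card_L L(2) by (auto simp: u_def)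
      also have "\<dots> = f L"
        using Suc.prems(2)[OF rC(1)[OF C] L(1)] rC(2)[OF C] by simp
      finally show ?thesis .
    qed
    have "\<exists>v \<in> carrier (burnside_ring G). \<forall>K. subgroup K G \<longrightarrow> mark G K v = f K - mark G K u"
    proof (rule Suc.IH)
      show "P (\<lambda>K. f K - mark G K u)" by (rule P_diff) (rule Suc.prems)
      show "f K - mark G K u = f L - mark G L u"
        if "subgroup K G" "subgroup L G" "subgroup_class G K = subgroup_class G L" for K L
        using Suc.prems(2)[OF that] mark_class[OF that] by simp
    qed (use u in auto)
    then obtain v where v: "\<And>K. subgroup K G \<Longrightarrow> mark G K v = f K - mark G K u" by blast
    define w where "w = (\<lambda>C \<in> subgroup_classes G. u C + v C)"
    have "w \<in> carrier (burnside_ring G)" by (simp add: w_def burnside_ring_def)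
    moreover have "mark G K w = f K" if "subgroup K G" for K
      unfolding w_def mark_add using v[OF that] by simp
    ultimately show ?case by blast
  qed
  moreover have "f L = 0" if "subgroup L G" "card (carrier G) < card L" for L
    using that card_mono[OF finite_carrier subgroup.subset[OF that(1)]] by simp
  ultimately show ?thesis using assms(4,5) by blast
qed

text \<open>Over a field the diagonal entries are invertible, so the elimination meets no
  divisibility condition and \<open>P\<close> can be trivial.\<close>

lemma exists_rational_marks:
  fixes f :: "'a set \<Rightarrow> rat"
  assumes "\<And>K L. subgroup K G \<Longrightarrow> subgroup L G \<Longrightarrow> subgroup_class G K = subgroup_class G L \<Longrightarrow> f K = f L"
  shows "\<exists>u \<in> carrier (burnside_rat G). \<forall>K. subgroup K G \<longrightarrow> mark G K u = f K"
proof (rule exists_marks[of class_rep "\<lambda>_. True"])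
  fix C and f :: "'a set \<Rightarrow> rat" assume "C \<in> subgroup_classes G"
  then show "\<exists>c. f (class_rep C) = c * of_nat (card (carrier (weyl_group G (class_rep C))))"
    using card_weyl_group_pos[OF subgroup_class_rep]
    by (intro exI[of _ "f (class_rep C) / of_nat (card (carrier (weyl_group G (class_rep C))))"]) auto
next
  show "f K = f L" if "subgroup K G" "subgroup L G" "subgroup_class G K = subgroup_class G L" for K L
    using that by (rule assms)
qed (auto intro: class_rep_in)

text \<open>The sum is linear in u, so the congruence for coset spaces extends to all integral
  combinations of them.\<close>

lemma burnside_congruence:
  assumes K: "subgroup K G"
  shows "int (card (carrier (weyl_group G K))) dvd
    (\<Sum>X \<in> carrier (weyl_group G K). mark G (generate G (K \<union> X)) u)"
proof -
  let ?W = "carrier (weyl_group G K)"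
  have "(\<Sum>X \<in> ?W. mark G (generate G (K \<union> X)) u) =
      (\<Sum>C \<in> subgroup_classes G. u C * int (\<Sum>X \<in> ?W. coset_mark G (generate G (K \<union> X)) (class_rep C)))"
    unfolding mark_def by (subst sum.swap) (simp add: sum_distrib_left)
  moreover have "int (card ?W) dvd
      (\<Sum>C \<in> subgroup_classes G. u C * int (\<Sum>X \<in> ?W. coset_mark G (generate G (K \<union> X)) (class_rep C)))"
  proof (intro dvd_sum dvd_mult)
    fix C assume "C \<in> subgroup_classes G"
    then have "group_action G (lcosets (class_rep C)) (coset_action G (class_rep C))"
      by (intro group_action_coset_action subgroup_class_rep)
    from group_action.weyl_burnside[OF this finite_carrier finite_lcosets K]
    show "int (card ?W) dvd int (\<Sum>X \<in> ?W. coset_mark G (generate G (K \<union> X)) (class_rep C))"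
      by (simp only: of_nat_dvd_iff)
  qed
  ultimately show ?thesis by simp
qed

text \<open>In the congruence at K every nontrivial coset refers to a strictly larger subgroup; this
  isolates the term of K itself.\<close>

lemma generate_coset_less:
  assumes K: "subgroup K G" and X: "X \<in> carrier (weyl_group G K)" "X \<noteq> K"
  shows "subgroup (generate G (K \<union> X)) G" "card K < card (generate G (K \<union> X))"
proof -
  obtain g where g: "g \<in> carrier G" "X = K #> g"
    using X(1) normalizer_subset[OF K] by (auto simp: carrier_weyl_group)
  show sub: "subgroup (generate G (K \<union> X)) G"
    using g subgroup.subset[OF K] r_coset_subset_G by (intro generate_is_subgroup) auto
  have "g \<notin> K" using g X(2) K by (auto simp: coset_join2)
  moreover have "g \<in> X" using g rcos_self K by auto
  ultimately have "K \<subset> generate G (K \<union> X)" by (auto intro: generate.incl)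
  then show "card K < card (generate G (K \<union> X))"
    using finite_subgroup[OF sub] psubset_card_mono by blast
qed

text \<open>\<open>P\<close> is the system of congruences at the representatives. Marks of integral
  elements satisfy it, so it survives elimination. Once f vanishes on all subgroups larger than
  \<open>r C\<close>, only the trivial coset contributes, and the congruence says that the diagonal
  entry divides \<open>f (r C)\<close>.\<close>

lemma exists_integral_marks:
  fixes f :: "'a set \<Rightarrow> int" and r :: "'a set set \<Rightarrow> 'a set"
  assumes r: "\<And>C. C \<in> subgroup_classes G \<Longrightarrow> r C \<in> C"
    and cong: "\<And>C. C \<in> subgroup_classes G \<Longrightarrow> int (card (carrier (weyl_group G (r C)))) dvd
      (\<Sum>X \<in> carrier (weyl_group G (r C)). f (generate G (r C \<union> X)))"
    and invariant: "\<And>K L. subgroup K G \<Longrightarrow> subgroup L G \<Longrightarrow> subgroup_class G K = subgroup_class G L \<Longrightarrow> f K = f L"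
  shows "\<exists>u \<in> carrier (burnside_int G). \<forall>K. subgroup K G \<longrightarrow> mark G K u = f K"
proof -
  have rC: "subgroup (r C) G" if "C \<in> subgroup_classes G" for C
    using that r subgroup_classesD by blast
  define P where "P f \<longleftrightarrow> (\<forall>C \<in> subgroup_classes G. int (card (carrier (weyl_group G (r C)))) dvd
    (\<Sum>X \<in> carrier (weyl_group G (r C)). f (generate G (r C \<union> X))))" for f
  have "P (\<lambda>K. f K - mark G K u)" if "P f" for f u
    using that burnside_congruence[OF rC] by (simp add: P_def sum_subtractf dvd_diff)
  moreover have "\<exists>c. f (r C) = c * of_nat (card (carrier (weyl_group G (r C))))"
    if "P f" and C: "C \<in> subgroup_classes G"
      and van: "\<And>L. subgroup L G \<Longrightarrow> card (r C) < card L \<Longrightarrow> f L = 0" for f C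
  proof -
    let ?W = "carrier (weyl_group G (r C))"
    have one: "r C \<in> ?W"
      using group.is_monoid[OF group_weyl_group[OF rC[OF C]]] monoid.one_closed by fastforce
    have "f (generate G (r C \<union> X)) = 0" if "X \<in> ?W - {r C}" for X
      using that van generate_coset_less[OF rC[OF C], of X] by simp
    then have "(\<Sum>X \<in> ?W. f (generate G (r C \<union> X))) = (\<Sum>X \<in> {r C}. f (generate G (r C \<union> X)))"
      using one weyl_group_finite[OF rC[OF C]] by (intro sum.mono_neutral_right) auto
    also have "\<dots> = f (r C)"
      using generate_subgroup[OF rC[OF C]] by simp
    finally have "int (card ?W) dvd f (r C)"
      using \<open>P f\<close> C unfolding P_def by metis
    then show ?thesis
      by (elim dvdE) (simp add: mult.commute)
  qed
  moreover have "P f" using cong by (simp add: P_def)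
  ultimately show ?thesis
    using exists_marks[where P = P and r = r and f = f] r invariant by blast
qed

end

section \<open>The ring structure seen through marks, and the primitive idempotents\<close>

lemma group_action_prod_action:
  assumes "group_action G E \<phi>" "group_action G F \<psi>"
  shows "group_action G (E \<times> F) (prod_action E \<phi> F \<psi>)"
proof -
  interpret E: group_action G E \<phi> by fact
  interpret F: group_action G F \<psi> by fact
  show ?thesis
    by (rule group_actionI)
      (auto simp: E.is_group prod_action_def E.action_mult F.action_mult)
qed

lemma fixed_points_prod_action:
  "fixed_points (E \<times> F) (prod_action E \<phi> F \<psi>) K = fixed_points E \<phi> K \<times> fixed_points F \<psi> K"
  by (auto simp: fixed_points_def prod_action_def)

lemma burnside_ring_carrier_iff:
  "u \<in> carrier (burnside_ring G) \<longleftrightarrow> u \<in> extensional (subgroup_classes G)"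
  by (simp add: burnside_ring_def PiE_UNIV_domain PiE_def)

lemma burnside_mult_closed: "u \<otimes>\<^bsub>burnside_ring G\<^esub> v \<in> carrier (burnside_ring G)"
  by (simp add: burnside_ring_carrier_iff) (simp add: burnside_ring_def)

lemma burnside_zero: "\<zero>\<^bsub>burnside_ring G\<^esub> = (\<lambda>C \<in> subgroup_classes G. 0)"
  by (simp add: burnside_ring_def)

lemma burnside_add: "u \<oplus>\<^bsub>burnside_ring G\<^esub> v = (\<lambda>C \<in> subgroup_classes G. u C + v C)"
  by (simp add: burnside_ring_def)

text \<open>Serves to unfold the finite sum that defines e_S and the multiple 2e_S.\<close>

lemma abelian_monoid_burnside_ring: "abelian_monoid (burnside_ring G)"
proof (rule abelian_monoidI)
  show "\<zero>\<^bsub>burnside_ring G\<^esub> \<oplus>\<^bsub>burnside_ring G\<^esub> u = u" if "u \<in> carrier (burnside_ring G)" for u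
    using that by (intro extensionalityI[of _ "subgroup_classes G"])
      (auto simp: burnside_ring_carrier_iff burnside_zero burnside_add)
qed (auto simp: burnside_ring_carrier_iff burnside_zero burnside_add add.assoc add.commute intro!: restrict_ext)

lemma mark_zero: "mark G K \<zero>\<^bsub>burnside_ring G\<^esub> = 0"
  by (simp add: mark_def burnside_zero)

context fin_group
begin

lemma mark_plus: "mark G K (u \<oplus>\<^bsub>burnside_ring G\<^esub> v) = mark G K u + mark G K v"
  unfolding burnside_add by (rule mark_add)

text \<open>Basis elements multiply as products of G-sets, and the K-fixed points of a product are
  the product of the K-fixed points; the rest is bilinear rearrangement.\<close>

lemma mark_mult:
  fixes u v :: "'a set set \<Rightarrow> 'r :: comm_ring_1"
  assumes K: "subgroup K G"
  shows "mark G K (u \<otimes>\<^bsub>burnside_ring G\<^esub> v) = mark G K u * mark G K v"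
proof -
  let ?S = "subgroup_classes G"
  let ?E = "\<lambda>A. lcosets (class_rep A)" and ?\<phi> = "\<lambda>A. coset_action G (class_rep A)"
  define g :: "'a set set \<Rightarrow> 'a set set \<Rightarrow> 'a set set \<Rightarrow> 'r" where
    "g A B = gset_class G (?E A \<times> ?E B) (prod_action (?E A) (?\<phi> A) (?E B) (?\<phi> B))" for A B
  define m :: "'a set set \<Rightarrow> 'r" where "m C = of_nat (coset_mark G K (class_rep C))" for C
  have g: "(\<Sum>C \<in> ?S. g A B C * m C) = m A * m B" if AB: "A \<in> ?S" "B \<in> ?S" for A B
  proof -
    have "group_action G (?E A \<times> ?E B) (prod_action (?E A) (?\<phi> A) (?E B) (?\<phi> B))"
      using AB by (intro group_action_prod_action group_action_coset_action subgroup_class_rep)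
    then have "mark G K (g A B) = of_nat (card (fixed_points (?E A) (?\<phi> A) K \<times> fixed_points (?E B) (?\<phi> B) K))"
      unfolding g_def fixed_points_prod_action[symmetric]
      using finite_lcosets subgroup.subset[OF K] by (intro group_action.mark_gset_class) auto
    then show ?thesis
      by (simp add: mark_def m_def card_cartesian_product)
  qed
  have "mark G K (u \<otimes>\<^bsub>burnside_ring G\<^esub> v)
      = (\<Sum>C \<in> ?S. (\<Sum>A \<in> ?S. \<Sum>B \<in> ?S. u A * v B * g A B C) * m C)"
    by (simp add: mark_def burnside_ring_def g_def m_def)
  also have "\<dots> = (\<Sum>C \<in> ?S. \<Sum>A \<in> ?S. \<Sum>B \<in> ?S. u A * v B * (g A B C * m C))"
    by (simp add: sum_distrib_right mult.assoc)
  also have "\<dots> = (\<Sum>A \<in> ?S. \<Sum>C \<in> ?S. \<Sum>B \<in> ?S. u A * v B * (g A B C * m C))"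
    by (rule sum.swap)
  also have "\<dots> = (\<Sum>A \<in> ?S. \<Sum>B \<in> ?S. \<Sum>C \<in> ?S. u A * v B * (g A B C * m C))"
    by (intro sum.cong refl sum.swap)
  also have "\<dots> = (\<Sum>A \<in> ?S. \<Sum>B \<in> ?S. u A * v B * (m A * m B))"
    by (intro sum.cong refl) (simp add: sum_distrib_left[symmetric] g)
  also have "\<dots> = (\<Sum>A \<in> ?S. u A * m A) * (\<Sum>B \<in> ?S. v B * m B)"
    by (simp add: sum_product mult_ac)
  finally show ?thesis by (simp add: mark_def m_def)
qed

lemma mark_idempotent:
  fixes e :: "'a set set \<Rightarrow> rat"
  assumes "idempotent (burnside_rat G) e" "subgroup K G"
  shows "mark G K e = 0 \<or> mark G K e = 1"
proof -
  have "mark G K e * mark G K e = mark G K e"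
    using assms mark_mult[OF assms(2), of e e] by (simp add: idempotent_def)
  then show ?thesis by simp
qed

text \<open>The definite description has to be resolved. An element with indicator marks exists over
  the rationals and is unique because marks are injective. It is primitive: in a splitting e = a + b
  both parts have marks 0 off C, and at C one of them has mark 0 since ab = 0.\<close>

lemma burnside_idem:
  assumes C: "C \<in> subgroup_classes G"
  shows "burnside_idem G C \<in> carrier (burnside_rat G)"
    and "\<And>K. subgroup K G \<Longrightarrow> mark G K (burnside_idem G C) = of_bool (subgroup_class G K = C)"
proof -
  let ?R = "burnside_rat G"
  let ?P = "\<lambda>e. primitive_idempotent ?R e \<and>
     (\<forall>K. subgroup K G \<longrightarrow> mark G K e = (if subgroup_class G K = C then 1 else 0))"
  obtain K0 where K0: "subgroup K0 G" "subgroup_class G K0 = C"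
    using C subgroup_class_rep subgroup_class_class_rep by blast
  have "\<exists>e \<in> carrier ?R. \<forall>K. subgroup K G \<longrightarrow> mark G K e = (if subgroup_class G K = C then 1 else 0)"
    by (rule exists_rational_marks) simp
  then obtain e where e: "e \<in> carrier ?R"
    "\<And>K. subgroup K G \<Longrightarrow> mark G K e = (if subgroup_class G K = C then 1 else 0)" by blast
  have zero_carrier: "\<zero>\<^bsub>?R\<^esub> \<in> carrier ?R" by (simp add: burnside_ring_carrier_iff burnside_zero)
  have "e \<otimes>\<^bsub>?R\<^esub> e = e"
    using e by (intro marks_inject burnside_mult_closed) (auto simp: mark_mult)
  moreover have "e \<noteq> \<zero>\<^bsub>?R\<^esub>"
    using e(2)[OF K0(1)] K0(2) by (auto simp: mark_zero)
  moreover have "a = \<zero>\<^bsub>?R\<^esub> \<or> b = \<zero>\<^bsub>?R\<^esub>"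
    if ab: "idempotent ?R a" "idempotent ?R b" "a \<otimes>\<^bsub>?R\<^esub> b = \<zero>\<^bsub>?R\<^esub>" "a \<oplus>\<^bsub>?R\<^esub> b = e" for a b
  proof -
    have sum: "mark G K a + mark G K b = (if subgroup_class G K = C then 1 else 0)" if "subgroup K G" for K
      using mark_plus[of K a b] e(2)[OF that] ab(4) by simp
    \<comment> \<open>Two values in {0, 1} with sum 0 both vanish.\<close>
    have other: "mark G K a = 0 \<and> mark G K b = 0" if "subgroup K G" "subgroup_class G K \<noteq> C" for K
      using sum[OF that(1)] that(2) mark_idempotent[OF ab(1) that(1)] mark_idempotent[OF ab(2) that(1)] by auto
    have "x = \<zero>\<^bsub>?R\<^esub>" if x: "idempotent ?R x" "mark G K0 x = 0"
      and "\<And>K. subgroup K G \<Longrightarrow> subgroup_class G K \<noteq> C \<Longrightarrow> mark G K x = 0" for x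
    proof (rule marks_inject)
      show "mark G K x = mark G K \<zero>\<^bsub>?R\<^esub>" if "subgroup K G" for K
        using that x(2) mark_class[OF that K0(1), of x] \<open>\<And>K. _ \<Longrightarrow> _ \<Longrightarrow> mark G K x = 0\<close>[of K] K0(2)
        by (auto simp: mark_zero)
    qed (use x zero_carrier in \<open>auto simp: idempotent_def\<close>)
    moreover have "mark G K0 a = 0 \<or> mark G K0 b = 0"
      using mark_mult[OF K0(1), of a b] ab(3) by (auto simp: mark_zero)
    ultimately show ?thesis using ab other by blast
  qed
  ultimately have "?P e"
    using e by (simp add: primitive_idempotent_def idempotent_def)
  moreover have "e' = e" if "?P e'" for e'
  proof (rule marks_inject)
    show "e' \<in> carrier ?R" using that by (simp add: primitive_idempotent_def idempotent_def)
    show "mark G K e' = mark G K e" if "subgroup K G" for K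
      using that \<open>?P e'\<close> e(2)[OF that] by simp
  qed fact
  ultimately have "burnside_idem G C = e"
    unfolding burnside_idem_def by (rule the_equality)
  then show "burnside_idem G C \<in> carrier ?R"
    and "\<And>K. subgroup K G \<Longrightarrow> mark G K (burnside_idem G C) = of_bool (subgroup_class G K = C)"
    using e by auto
qed

lemma burnside_idem_set:
  assumes "S \<subseteq> subgroup_classes G"
  shows "burnside_idem_set G S \<in> carrier (burnside_rat G) \<and>
    (\<forall>K. subgroup K G \<longrightarrow> mark G K (burnside_idem_set G S) = of_bool (subgroup_class G K \<in> S))"
proof -
  interpret R: abelian_monoid "burnside_rat G" by (rule abelian_monoid_burnside_ring)
  have "finite S" using assms finite_subset finite_subgroup_classes by blast
  then show ?thesis
    using assms
  proof (induction S)
    case empty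
    then show ?case by (simp add: burnside_idem_set_def mark_zero)
  next
    case (insert C S)
    then have "burnside_idem_set G (insert C S) = burnside_idem G C \<oplus>\<^bsub>burnside_rat G\<^esub> burnside_idem_set G S"
      using burnside_idem(1) unfolding burnside_idem_set_def by (intro R.finsum_insert) auto
    then show ?case
      using insert burnside_idem[of C] by (auto simp: mark_plus)
  qed
qed

lemma mark_burnside_incl: "mark G K (burnside_incl G u) = of_int (mark G K u)"
  by (simp add: mark_def burnside_incl_def)

lemma ncc_classes_subset: "ncc_classes G \<subseteq> subgroup_classes G"
  by (auto simp: ncc_classes_def Sub_ncc_def subgroup_class_in_classes)

text \<open>The inclusion of integral coefficients preserves marks, and rational elements are
  determined by their marks. So idempotents are traded for a question about prescribed
  marks.\<close>

lemma S2_sets_iff_marks: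
  "S \<in> S2_sets G \<longleftrightarrow> S \<subseteq> ncc_classes G \<and>
    (\<exists>u \<in> carrier (burnside_int G). \<forall>K. subgroup K G \<longrightarrow> mark G K u = 2 * of_bool (subgroup_class G K \<in> S))"
proof (cases "S \<subseteq> ncc_classes G")
  case True
  interpret R: abelian_monoid "burnside_rat G" by (rule abelian_monoid_burnside_ring)
  let ?e = "burnside_idem_set G S"
  have e: "?e \<in> carrier (burnside_rat G)"
    "\<And>K. subgroup K G \<Longrightarrow> mark G K ?e = of_bool (subgroup_class G K \<in> S)"
    using burnside_idem_set True ncc_classes_subset by blast+
  have two: "[(2::nat)] \<cdot>\<^bsub>burnside_rat G\<^esub> ?e = ?e \<oplus>\<^bsub>burnside_rat G\<^esub> ?e"
    using e(1) by (simp add: numeral_2_eq_2)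
  have "[(2::nat)] \<cdot>\<^bsub>burnside_rat G\<^esub> ?e = burnside_incl G u \<longleftrightarrow>
      (\<forall>K. subgroup K G \<longrightarrow> mark G K u = 2 * of_bool (subgroup_class G K \<in> S))" for u
  proof -
    have "[(2::nat)] \<cdot>\<^bsub>burnside_rat G\<^esub> ?e = burnside_incl G u \<longleftrightarrow>
        (\<forall>K. subgroup K G \<longrightarrow> mark G K ([(2::nat)] \<cdot>\<^bsub>burnside_rat G\<^esub> ?e) = mark G K (burnside_incl G u))"
      using e(1) by (auto intro!: marks_inject simp: burnside_incl_def burnside_ring_carrier_iff[of "restrict _ _"])
    also have "\<dots> \<longleftrightarrow> (\<forall>K. subgroup K G \<longrightarrow> of_int (mark G K u) = (of_int (2 * of_bool (subgroup_class G K \<in> S)) :: rat))"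
      using e(2) by (auto simp: two mark_plus mark_burnside_incl)
    finally show ?thesis by (simp only: of_int_eq_iff)
  qed
  then show ?thesis
    using True by (simp add: S2_sets_def image_iff)
qed (auto simp: S2_sets_def)

end

section \<open>Yoshida's criterion\<close>

text \<open>Translation by an element of value 1 exchanges the fibres over 0 and 1, so each is half
  of the group; without such an element one fibre is everything. The factor 2 accounts for the
  halves.\<close>

lemma (in group) card_kernel_bit_hom:
  fixes l :: "'a \<Rightarrow> bit"
  assumes fin: "finite (carrier G)"
    and hom: "\<And>x y. x \<in> carrier G \<Longrightarrow> y \<in> carrier G \<Longrightarrow> l (x \<otimes> y) = l x + l y"
  shows "card (carrier G) dvd 2 * card {x \<in> carrier G. l x = b}"
proof (cases "\<exists>a \<in> carrier G. l a = 1")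
  case True
  then obtain a where a: "a \<in> carrier G" "l a = 1" by blast
  have la: "l (inv a) = 1"
    using hom[of a "inv a"] hom[of \<one> \<one>] a by (simp add: add_eq_0_iff)
  have "card {x \<in> carrier G. l x = 0} = card {x \<in> carrier G. l x = 1}"
  proof (rule bij_betw_same_card[of "\<lambda>x. x \<otimes> a"], rule bij_betw_byWitness[where f' = "\<lambda>x. x \<otimes> inv a"])
  qed (use a la in \<open>auto simp: hom m_assoc\<close>)
  moreover have "card (carrier G) = card {x \<in> carrier G. l x = 0} + card {x \<in> carrier G. l x = 1}"
  proof -
    have "carrier G = {x \<in> carrier G. l x = 0} \<union> {x \<in> carrier G. l x = 1}"
      using bit_not_one_iff by auto
    moreover have "{x \<in> carrier G. l x = 0} \<inter> {x \<in> carrier G. l x = 1} = {}" by auto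
    ultimately show ?thesis
      using fin card_Un_disjoint[of "{x \<in> carrier G. l x = 0}" "{x \<in> carrier G. l x = 1}"] by simp
  qed
  ultimately show ?thesis by (cases b) (simp_all add: mult_2)
next
  case False
  then have "l x = 0" if "x \<in> carrier G" for x
    using that bit_not_one_iff by blast
  then have "{x \<in> carrier G. l x = b} = (if b = 0 then carrier G else {})" by auto
  then show ?thesis by auto
qed

context fin_group
begin

text \<open>The determinant of the virtual permutation representation of \<open>N\<^sub>G(K)\<close> on the \<open>K\<close>-fixed points is
  the homomorphism sought.\<close>

lemma hom_of_two_marks:
  fixes u :: "'a set set \<Rightarrow> int" and S :: "'a set set set"
  defines "z \<equiv> \<lambda>L. of_bool (subgroup_class G L \<in> S) :: bit"
  assumes u: "\<And>L. subgroup L G \<Longrightarrow> mark G L u = 2 * of_bool (subgroup_class G L \<in> S)"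
    and K: "subgroup K G" and g: "g \<in> normalizer G K" and h: "h \<in> normalizer G K"
  shows "z (generate G (insert (g \<otimes> h) K)) + z K
    = (z (generate G (insert g K)) + z K) + (z (generate G (insert h K)) + z K)"
proof -
  let ?N = "normalizer G K"
  define X where "X C = fixed_points (lcosets (class_rep C)) (coset_action G (class_rep C)) K" for C
  \<comment> \<open>Extended by the identity, so that \<open>permutes\<close> and
    \<open>evenperm\<close> apply to a total function.\<close>
  define p where "p g C x = (if x \<in> X C then coset_action G (class_rep C) g x else x)" for g C x
  have NG: "?N \<subseteq> carrier G" by (rule normalizer_subset[OF K])
  have act: "group_action G (lcosets (class_rep C)) (coset_action G (class_rep C))"
    if "C \<in> subgroup_classes G" for C
    using that by (intro group_action_coset_action subgroup_class_rep)
  have XE: "X C \<subseteq> lcosets (class_rep C)" for C by (auto simp: X_def fixed_points_def)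
  have finX: "finite (X C)" for C using XE finite_lcosets finite_subset by blast
  have Nact: "group_action (G\<lparr>carrier := ?N\<rparr>) (X C) (\<lambda>g. restrict (coset_action G (class_rep C) g) (X C))"
    if "C \<in> subgroup_classes G" for C
    unfolding X_def by (rule group_action.normalizer_acts_on_fixed_points[OF act[OF that] K])
  have p_in: "p g C x \<in> X C" if "g \<in> ?N" "C \<in> subgroup_classes G" "x \<in> X C" for g C x
    using group_action.action_closed[OF Nact[OF that(2)], of g x] that by (simp add: p_def)
  have p_mult: "p (g \<otimes> h) C = p g C \<circ> p h C" if "g \<in> ?N" "h \<in> ?N" "C \<in> subgroup_classes G" for g h C
  proof
    fix x
    show "p (g \<otimes> h) C x = (p g C \<circ> p h C) x"
      using that p_in[of h C x] group_action.action_mult[OF act, of C g h x] XE[of C] NG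
      by (auto simp: p_def)
  qed
  have p_perm: "p g C permutes X C" if "g \<in> ?N" "C \<in> subgroup_classes G" for g C
  proof (rule bij_imp_permutes)
    have "bij_betw (restrict (coset_action G (class_rep C) g) (X C)) (X C) (X C)"
      using group_action.bij_prop0[OF Nact[OF that(2)], of g] that(1) by (simp add: Bij_def)
    then show "bij_betw (p g C) (X C) (X C)"
      by (rule bij_betw_cong[THEN iffD1, rotated]) (simp add: p_def)
  qed (simp add: p_def)
  have one_N: "\<one> \<in> ?N" using subgroup.one_closed[OF subgroup_normalizer[OF K]] .
  have pow_N: "g [^] i \<in> ?N" if "g \<in> ?N" for g and i :: nat
    using that subgroup.m_closed[OF subgroup_normalizer[OF K]] one_N by (induction i) auto
  have p_one: "p \<one> C = id" if "C \<in> subgroup_classes G" for C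
    using group_action.action_one[OF act[OF that]] XE by (auto simp: p_def fun_eq_iff)
  have p_pow: "p g C ^^ i = p (g [^] i) C" if "g \<in> ?N" "C \<in> subgroup_classes G" for g C and i :: nat
  proof (induction i)
    case 0
    then show ?case using p_one[OF that(2)] by (simp add: id_def)
  next
    case (Suc i)
    have "p (g [^] Suc i) C = p (g [^] i) C \<circ> p g C"
      using p_mult[OF pow_N[OF that(1)] that] by simp
    then show ?case using Suc by (simp only: funpow_Suc_right)
  qed
  have sub: "subgroup (generate G (insert g K)) G" if "g \<in> ?N" for g
    using that NG subgroup.subset[OF K] by (intro generate_is_subgroup) auto
  have mark_N: "mark G (generate G (insert g K)) u = (\<Sum>C \<in> subgroup_classes G. u C * int (card {x \<in> X C. p g C x = x}))"
    if "g \<in> ?N" for g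
  proof -
    have "fixed_points (lcosets (class_rep C)) (coset_action G (class_rep C)) (generate G (insert g K))
        = {x \<in> X C. p g C x = x}" if "C \<in> subgroup_classes G" for C
    proof -
      have "insert g K \<subseteq> carrier G" using \<open>g \<in> ?N\<close> NG subgroup.subset[OF K] by auto
      from group_action.fixed_points_generate[OF act[OF that] this] show ?thesis
        by (auto simp: X_def p_def fixed_points_def)
    qed
    then show ?thesis by (simp add: mark_def)
  qed
  \<comment> \<open>The determinant is the product of the signs raised to the powers
    \<open>u C\<close>. It is recorded by this integer, of which only the parity counts.\<close>
  define \<sigma> where "\<sigma> g = (\<Sum>C \<in> subgroup_classes G. u C * of_bool (\<not> evenperm (p g C)))" for g
  have key: "even (\<sigma> g) \<longleftrightarrow> z (generate G (insert g K)) + z K = 0" if g: "g \<in> ?N" for g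
  proof -
    define f where "f i = mark G (generate G (insert (g [^] i) K)) u" for i :: nat
    have f: "f i = (\<Sum>C \<in> subgroup_classes G. u C * int (card {x \<in> X C. (p g C ^^ i) x = x}))" for i
      unfolding f_def mark_N[OF pow_N[OF g]] using p_pow[OF g] by simp
    have f02: "f i \<in> {0, 2}" for i
      unfolding f_def using u[OF sub[OF pow_N[OF g]]] by auto
    have pos: "0 < order G" using finite_carrier one_closed by (auto simp: order_def card_gt_0_iff)
    note vs = virtual_sign_from_marks[where I = "subgroup_classes G" and X = X and p = "p g" and u = u and f = f,
        OF finite_subgroup_classes finX p_perm[OF g] f f02]
    \<comment> \<open>All positive even exponents give the same value, and twice the group order is
      an even exponent that kills g. So the value at the square of g is the mark at K.\<close>
    have "f 2 = f (2 * order G)" using vs(1)[OF _ pos] by simp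
    also have "g [^] (2 * order G) = \<one>"
      using g NG pow_order_eq_1[of g] nat_pow_pow[of g "order G" 2] by (auto simp: mult.commute)
    then have "f (2 * order G) = mark G K u"
      using generate_subgroup[OF K] subgroup.one_closed[OF K] by (simp add: f_def insert_absorb)
    finally have "f 2 = mark G K u" .
    moreover have "f 1 = mark G (generate G (insert g K)) u"
      using g NG by (auto simp: f_def)
    ultimately have "even (\<sigma> g) \<longleftrightarrow> mark G (generate G (insert g K)) u = mark G K u"
      using vs(2) by (simp add: \<sigma>_def)
    then show ?thesis
      using u[OF K] u[OF sub[OF g]] by (simp add: z_def)
  qed
  \<comment> \<open>The action on each fixed-point set is multiplicative, and so is the sign of a
    permutation.\<close>
  have "even (\<sigma> (g \<otimes> h) - (\<sigma> g + \<sigma> h))"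
  proof -
    have perm: "permutation (p g C)" if "g \<in> ?N" "C \<in> subgroup_classes G" for g C
      using p_perm[OF that] finX permutation_permutes by blast
    have "evenperm (p (g \<otimes> h) C) \<longleftrightarrow> (evenperm (p g C) \<longleftrightarrow> evenperm (p h C))" if "C \<in> subgroup_classes G" for C
      unfolding p_mult[OF g h that] using evenperm_comp[OF perm[OF g that] perm[OF h that]] .
    then have "even (u C * of_bool (\<not> evenperm (p (g \<otimes> h) C))
        - (u C * of_bool (\<not> evenperm (p g C)) + u C * of_bool (\<not> evenperm (p h C))))"
      if "C \<in> subgroup_classes G" for C
      using that by (auto simp: of_bool_def)
    then show ?thesis
      unfolding \<sigma>_def sum.distrib[symmetric] sum_subtractf[symmetric] by (intro dvd_sum) auto
  qed
  then have "even (\<sigma> (g \<otimes> h)) \<longleftrightarrow> (even (\<sigma> g) \<longleftrightarrow> even (\<sigma> h))"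
    by auto
  moreover have "g \<otimes> h \<in> ?N"
    using g h subgroup.m_closed[OF subgroup_normalizer[OF K]] by blast
  ultimately have "z (generate G (insert (g \<otimes> h) K)) + z K = 0 \<longleftrightarrow>
      (z (generate G (insert g K)) + z K = 0 \<longleftrightarrow> z (generate G (insert h K)) + z K = 0)"
    using key g h by simp
  \<comment> \<open>An element of F_2 is determined by whether it is 0, so agreement of parities is
    already additivity.\<close>
  moreover have "a = b + c" if "a = 0 \<longleftrightarrow> (b = 0 \<longleftrightarrow> c = 0)" for a b c :: bit
    using that by (cases a; cases b; cases c) auto
  ultimately show ?thesis by blast
qed

lemma two_marks_of_hom:
  fixes r :: "'a set set \<Rightarrow> 'a set" and S :: "'a set set set"
  defines "z \<equiv> \<lambda>L. of_bool (subgroup_class G L \<in> S) :: bit"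
  assumes r: "\<And>C. C \<in> subgroup_classes G \<Longrightarrow> r C \<in> C"
    and hom: "\<And>C X Y. C \<in> subgroup_classes G \<Longrightarrow> X \<in> carrier (weyl_group G (r C)) \<Longrightarrow> Y \<in> carrier (weyl_group G (r C))
      \<Longrightarrow> z (generate G (r C \<union> X \<otimes>\<^bsub>weyl_group G (r C)\<^esub> Y)) + z (r C)
        = (z (generate G (r C \<union> X)) + z (r C)) + (z (generate G (r C \<union> Y)) + z (r C))"
  shows "\<exists>u \<in> carrier (burnside_int G). \<forall>K. subgroup K G \<longrightarrow> mark G K u = 2 * of_bool (subgroup_class G K \<in> S)"
proof (rule exists_integral_marks[OF r])
  fix C assume C: "C \<in> subgroup_classes G"
  then have K: "subgroup (r C) G" using r subgroup_classesD by blast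
  let ?W = "weyl_group G (r C)"
  define l where "l X = z (generate G (r C \<union> X)) + z (r C)" for X
  \<comment> \<open>The value \<open>1 + z (r C)\<close> picks out the cosets whose generated
    subgroup has its class in S, whether or not the class of \<open>r C\<close> is in S.\<close>
  have "card (carrier ?W) dvd 2 * card {X \<in> carrier ?W. l X = 1 + z (r C)}"
    using hom[OF C] weyl_group_finite[OF K]
    by (intro group.card_kernel_bit_hom[OF group_weyl_group[OF K]]) (auto simp: l_def)
  moreover have "(l X = 1 + z (r C)) \<longleftrightarrow> subgroup_class G (generate G (r C \<union> X)) \<in> S" for X
    by (simp add: l_def z_def)
  ultimately have "int (card (carrier ?W)) dvd
      int (2 * card {X \<in> carrier ?W. subgroup_class G (generate G (r C \<union> X)) \<in> S})"
    by (simp only: of_nat_dvd_iff)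
  also have "int (2 * card {X \<in> carrier ?W. subgroup_class G (generate G (r C \<union> X)) \<in> S})
      = (\<Sum>X \<in> carrier ?W. 2 * of_bool (subgroup_class G (generate G (r C \<union> X)) \<in> S))"
    using weyl_group_finite[OF K] by (simp add: sum_distrib_left[symmetric] Int_def)
  finally show "int (card (carrier ?W)) dvd
      (\<Sum>X \<in> carrier ?W. 2 * of_bool (subgroup_class G (generate G (r C \<union> X)) \<in> S))" .
next
  show "2 * of_bool (subgroup_class G K \<in> S) = (2 * of_bool (subgroup_class G L \<in> S) :: int)"
    if "subgroup_class G K = subgroup_class G L" for K L
    using that by simp
qed

end

section \<open>Vector spaces over the field with two elements\<close>

lemma field_F2: "field F2"
proof -
  have "cring F2"
  proof (rule cringI)
    show "abelian_group F2"
      by (rule abelian_groupI) (auto simp: F2_def add.assoc add.commute intro: exI[of _ "_ :: bit"])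
    show "Group.comm_monoid F2"
      by (rule comm_monoidI) (auto simp: F2_def mult_ac)
  qed (auto simp: F2_def distrib_right)
  moreover have "Units F2 = carrier F2 - {\<zero>\<^bsub>F2\<^esub>}"
    by (auto simp: Units_def F2_def)
  ultimately show ?thesis by (rule cring.cring_fieldI)
qed

lemma F2_simps [simp]:
  "carrier F2 = UNIV" "a \<oplus>\<^bsub>F2\<^esub> b = a + b" "a \<otimes>\<^bsub>F2\<^esub> b = a * b" "\<zero>\<^bsub>F2\<^esub> = 0" "\<one>\<^bsub>F2\<^esub> = 1"
  by (simp_all add: F2_def)

lemma func_space_F2:
  "carrier (ring.func_space F2 S) = S \<rightarrow>\<^sub>E UNIV"
  "\<zero>\<^bsub>ring.func_space F2 S\<^esub> = (\<lambda>v \<in> S. 0)"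
  "f \<oplus>\<^bsub>ring.func_space F2 S\<^esub> g = (\<lambda>v \<in> S. f v + g v)"
  "c \<odot>\<^bsub>ring.func_space F2 S\<^esub> f = (\<lambda>v \<in> S. c * f v)"
proof -
  interpret field F2 by (rule field_F2)
  show "carrier (ring.func_space F2 S) = S \<rightarrow>\<^sub>E UNIV"
    "\<zero>\<^bsub>ring.func_space F2 S\<^esub> = (\<lambda>v \<in> S. 0)"
    "f \<oplus>\<^bsub>ring.func_space F2 S\<^esub> g = (\<lambda>v \<in> S. f v + g v)"
    "c \<odot>\<^bsub>ring.func_space F2 S\<^esub> f = (\<lambda>v \<in> S. c * f v)"
    by (simp_all add: func_space_def)
qed

lemma vectorspace_func_space_F2: "vectorspace F2 (ring.func_space F2 S)"
proof -
  interpret field F2 by (rule field_F2)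
  show ?thesis
    by (simp add: vectorspace_def func_space_is_module field_F2)
qed

text \<open>Evaluation at the points of S reads off the coefficients of a combination of the point
  indicators \<open>d s\<close>, so these form a basis.\<close>

lemma func_space_F2_dim:
  assumes "finite S"
  shows "vectorspace.fin_dim F2 (ring.func_space F2 S)" "vectorspace.dim F2 (ring.func_space F2 S) = card S"
proof -
  let ?V = "ring.func_space F2 S"
  interpret vectorspace F2 ?V by (rule vectorspace_func_space_F2)
  define d :: "'a \<Rightarrow> 'a \<Rightarrow> bit" where "d s = (\<lambda>t \<in> S. of_bool (t = s))" for s
  have carrier: "carrier ?V = S \<rightarrow>\<^sub>E UNIV" by (simp add: func_space_F2)
  have dS: "d ` S \<subseteq> carrier ?V" by (auto simp: carrier d_def)
  have inj: "inj_on d S"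
  proof (rule inj_onI)
    fix s t assume "s \<in> S" "t \<in> S" "d s = d t"
    then have "d s s = d t s" by simp
    then show "s = t" using \<open>s \<in> S\<close> by (auto simp: d_def split: if_splits)
  qed
  have finsum_eval: "finsum ?V f A t = (\<Sum>x \<in> A. f x t)"
    if "finite A" "f ` A \<subseteq> carrier ?V" "t \<in> S" for f :: "('a \<Rightarrow> bit) \<Rightarrow> 'a \<Rightarrow> bit" and A t
    using that(1,2)
  proof (induction A)
    case empty
    then show ?case using that(3) by (simp add: func_space_F2)
  next
    case (insert a A)
    then have "finsum ?V f (insert a A) = f a \<oplus>\<^bsub>?V\<^esub> finsum ?V f A"
      by (intro M.finsum_insert) auto
    then show ?case using insert that(3) by (simp add: func_space_F2)
  qed
  have eval: "lincomb a (d ` S) t = a (d t)" if t: "t \<in> S" for a t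
  proof -
    have "lincomb a (d ` S) t = (\<Sum>v \<in> d ` S. (a v \<odot>\<^bsub>?V\<^esub> v) t)"
      unfolding lincomb_def
    proof (rule finsum_eval[OF _ _ t])
      show "(\<lambda>v. a v \<odot>\<^bsub>?V\<^esub> v) ` d ` S \<subseteq> carrier ?V"
        by (auto simp: func_space_F2)
    qed (use assms in simp)
    also have "\<dots> = (\<Sum>s \<in> S. a (d s) * d s t)"
      using t by (subst sum.reindex[OF inj]) (simp add: func_space_F2)
    also have "\<dots> = (\<Sum>s \<in> S. if s = t then a (d s) else 0)"
      using t by (intro sum.cong) (auto simp: d_def)
    finally show ?thesis using assms t by simp
  qed
  have "basis (d ` S)"
  proof (subst basis_criterion)
    show "\<forall>v. v \<in> carrier ?V \<longrightarrow> (\<exists>!a. a \<in> d ` S \<rightarrow>\<^sub>E carrier F2 \<and> lincomb a (d ` S) = v)"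
    proof (intro allI impI)
      fix v assume v: "v \<in> carrier ?V"
      have iff: "lincomb a (d ` S) = v \<longleftrightarrow> (\<forall>t \<in> S. a (d t) = v t)" for a
      proof
        show "\<forall>t \<in> S. a (d t) = v t" if "lincomb a (d ` S) = v"
          using that eval by metis
        show "lincomb a (d ` S) = v" if "\<forall>t \<in> S. a (d t) = v t"
        proof (rule extensionalityI[of _ S])
          have "lincomb a (d ` S) \<in> carrier ?V" using dS by (intro lincomb_closed) auto
          then show "lincomb a (d ` S) \<in> extensional S" by (simp add: carrier PiE_def)
        qed (use that eval v carrier in \<open>auto simp: PiE_def\<close>)
      qed
      show "\<exists>!a. a \<in> d ` S \<rightarrow>\<^sub>E carrier F2 \<and> lincomb a (d ` S) = v"
      \<comment> \<open>Coefficients are indexed by basis vectors, not by points, hence the inverse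
        of \<open>d\<close>.\<close>
      proof (rule ex1I[of _ "\<lambda>w \<in> d ` S. v (the_inv_into S d w)"])
        show "a = (\<lambda>w \<in> d ` S. v (the_inv_into S d w))"
          if "a \<in> d ` S \<rightarrow>\<^sub>E carrier F2 \<and> lincomb a (d ` S) = v" for a
          using that iff by (intro extensionalityI[of _ "d ` S"]) (auto simp: PiE_def the_inv_into_f_f[OF inj])
      qed (auto simp: iff the_inv_into_f_f[OF inj])
    qed
  qed (use assms dS in auto)
  then show "dim = card S" "fin_dim"
    using dim_basis[of "d ` S"] assms card_image[OF inj] dS by (auto simp: basis_def fin_dim_def)
qed

section \<open>Subspaces, quotients and direct sums\<close>

lemma vectorspace_submodule:
  assumes "vectorspace K V" "submodule K N V"
  shows "vectorspace K (V\<lparr>carrier := N\<rparr>)"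
  using assms module.submodule_is_module by (auto simp: vectorspace_def)

text \<open>The quotient is a bare record on sets of vectors. These rules move its operations to
  representatives, from which the vector space axioms are inherited.\<close>

lemma quotient_module_cosets:
  assumes V: "vectorspace K V" and N: "submodule K N V"
  shows "carrier (quotient_module V N) = (\<lambda>x. N +>\<^bsub>V\<^esub> x) ` carrier V"
    and "\<zero>\<^bsub>quotient_module V N\<^esub> = N +>\<^bsub>V\<^esub> \<zero>\<^bsub>V\<^esub>"
    and "x \<in> carrier V \<Longrightarrow> y \<in> carrier V \<Longrightarrow>
      (N +>\<^bsub>V\<^esub> x) \<oplus>\<^bsub>quotient_module V N\<^esub> (N +>\<^bsub>V\<^esub> y) = N +>\<^bsub>V\<^esub> (x \<oplus>\<^bsub>V\<^esub> y)"
    and "c \<in> carrier K \<Longrightarrow> x \<in> carrier V \<Longrightarrow>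
      c \<odot>\<^bsub>quotient_module V N\<^esub> (N +>\<^bsub>V\<^esub> x) = N +>\<^bsub>V\<^esub> (c \<odot>\<^bsub>V\<^esub> x)"
    and "x \<in> carrier V \<Longrightarrow> N +>\<^bsub>V\<^esub> x = N \<longleftrightarrow> x \<in> N"
proof -
  interpret vectorspace K V by fact
  interpret N: submodule K N V by fact
  have sub: "subgroup N (add_monoid V)"
  proof (rule group.subgroupI[OF M.a_group])
    show "inv\<^bsub>add_monoid V\<^esub> a \<in> N" if "a \<in> N" for a
    proof -
      have a: "a \<in> carrier V" using that N.subset by blast
      have "(\<ominus>\<^bsub>K\<^esub> \<one>\<^bsub>K\<^esub>) \<odot>\<^bsub>V\<^esub> a \<in> N" using that by simp
      then show ?thesis
        using smult_minus_1[OF a] by (simp add: a_inv_def)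
    qed
  next
    show "N \<noteq> {}" using N.zero_closed by blast
  qed (use N.subset in auto)
  interpret abelian_subgroup N V
    by (rule abelian_subgroupI3) (auto intro: additive_subgroup.intro sub M.abelian_group_axioms)
  show "carrier (quotient_module V N) = (\<lambda>x. N +>\<^bsub>V\<^esub> x) ` carrier V"
    by (auto simp: quotient_module_def A_RCOSETS_def')
  show "\<zero>\<^bsub>quotient_module V N\<^esub> = N +>\<^bsub>V\<^esub> \<zero>\<^bsub>V\<^esub>"
    using N.subset by (simp add: quotient_module_def M.a_coset_add_zero)
  show "(N +>\<^bsub>V\<^esub> x) \<oplus>\<^bsub>quotient_module V N\<^esub> (N +>\<^bsub>V\<^esub> y) = N +>\<^bsub>V\<^esub> (x \<oplus>\<^bsub>V\<^esub> y)"
    if "x \<in> carrier V" "y \<in> carrier V"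
    using that by (simp add: quotient_module_def a_rcos_sum)
  show "c \<odot>\<^bsub>quotient_module V N\<^esub> (N +>\<^bsub>V\<^esub> x) = N +>\<^bsub>V\<^esub> (c \<odot>\<^bsub>V\<^esub> x)"
    if c: "c \<in> carrier K" and x: "x \<in> carrier V"
  \<comment> \<open>Scalar multiplication is a union over all members of the coset; they all yield
    the same coset, and there is at least one of them.\<close>
  proof -
    have "N +>\<^bsub>V\<^esub> (c \<odot>\<^bsub>V\<^esub> y) = N +>\<^bsub>V\<^esub> (c \<odot>\<^bsub>V\<^esub> x)" if y: "y \<in> N +>\<^bsub>V\<^esub> x" for y
    proof -
      obtain n where n: "n \<in> N" "y = n \<oplus>\<^bsub>V\<^esub> x" using y by (auto simp: a_r_coset_def')
      then have "c \<odot>\<^bsub>V\<^esub> y = c \<odot>\<^bsub>V\<^esub> n \<oplus>\<^bsub>V\<^esub> c \<odot>\<^bsub>V\<^esub> x"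
        using c x N.subset by (auto simp: smult_r_distr)
      then have "c \<odot>\<^bsub>V\<^esub> y \<in> N +>\<^bsub>V\<^esub> (c \<odot>\<^bsub>V\<^esub> x)"
        using n c by (auto simp: a_r_coset_def')
      then show ?thesis
        using M.a_repr_independence[OF _ _ sub] c x by simp
    qed
    moreover have "N +>\<^bsub>V\<^esub> x \<noteq> {}" using N.zero_closed unfolding a_r_coset_def' by blast
    ultimately show ?thesis by (simp add: quotient_module_def)
  qed
  show "N +>\<^bsub>V\<^esub> x = N \<longleftrightarrow> x \<in> N" if "x \<in> carrier V"
    using M.a_coset_join1[OF _ that sub] M.a_coset_join2[OF that sub] by blast
qed

lemma vectorspace_quotient_module:
  assumes "vectorspace K V" "submodule K N V"
  shows "vectorspace K (quotient_module V N)"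
proof -
  interpret vectorspace K V by fact
  note q = quotient_module_cosets[OF assms]
  show ?thesis
  proof (rule vs_criteria)
    show "field K" by unfold_locales
    show "\<forall>v \<in> carrier (quotient_module V N). \<exists>w \<in> carrier (quotient_module V N).
        v \<oplus>\<^bsub>quotient_module V N\<^esub> w = \<zero>\<^bsub>quotient_module V N\<^esub>"
    proof
      fix v assume "v \<in> carrier (quotient_module V N)"
      then obtain x where x: "x \<in> carrier V" "v = N +>\<^bsub>V\<^esub> x" by (auto simp: q)
      then show "\<exists>w \<in> carrier (quotient_module V N). v \<oplus>\<^bsub>quotient_module V N\<^esub> w = \<zero>\<^bsub>quotient_module V N\<^esub>"
        by (intro bexI[of _ "N +>\<^bsub>V\<^esub> (\<ominus>\<^bsub>V\<^esub> x)"]) (simp_all add: q M.r_neg)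
    qed
  qed (auto simp: q M.a_ac smult_assoc1 smult_l_distr smult_r_distr)
qed

lemma vectorspace_family_direct_sum:
  assumes "field K" and M: "\<And>i. i \<in> I \<Longrightarrow> vectorspace K (M i)"
  shows "vectorspace K (family_direct_sum I M)"
proof -
  have m: "module K (M i)" if "i \<in> I" for i using M[OF that] by (simp add: vectorspace_def)
  have ab: "abelian_group (M i)" if "i \<in> I" for i using m[OF that] by (simp add: module_def)
  note mem = PiE_mem[where S = I and T = "\<lambda>i. carrier (M i)"] PiE_arb[where S = I and T = "\<lambda>i. carrier (M i)"]
  note am = abelian_group.axioms(1)[OF ab]
  show ?thesis
  proof (rule vs_criteria[OF \<open>field K\<close>])
    show "\<forall>v \<in> carrier (family_direct_sum I M). \<exists>w \<in> carrier (family_direct_sum I M).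
        v \<oplus>\<^bsub>family_direct_sum I M\<^esub> w = \<zero>\<^bsub>family_direct_sum I M\<^esub>"
    proof
      fix v assume v: "v \<in> carrier (family_direct_sum I M)"
      then show "\<exists>w \<in> carrier (family_direct_sum I M). v \<oplus>\<^bsub>family_direct_sum I M\<^esub> w = \<zero>\<^bsub>family_direct_sum I M\<^esub>"
        by (intro bexI[of _ "\<lambda>i \<in> I. \<ominus>\<^bsub>M i\<^esub> v i"])
          (auto simp: family_direct_sum_def mem abelian_group.a_inv_closed[OF ab] abelian_group.r_neg[OF ab] intro!: restrict_ext)
    qed
  next
    show "\<forall>v w. v \<in> carrier (family_direct_sum I M) \<and> w \<in> carrier (family_direct_sum I M) \<longrightarrow>
        v \<oplus>\<^bsub>family_direct_sum I M\<^esub> w = w \<oplus>\<^bsub>family_direct_sum I M\<^esub> v"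
      by (auto simp: family_direct_sum_def mem abelian_monoid.a_comm[OF am] intro!: restrict_ext)
  qed (auto simp: family_direct_sum_def mem
      abelian_monoid.zero_closed[OF am] abelian_monoid.a_closed[OF am]
      abelian_monoid.a_assoc[OF am] abelian_monoid.r_zero[OF am] module.smult_closed[OF m]
      module.smult_assoc1[OF m] module.smult_one[OF m] module.smult_l_distr[OF m] module.smult_r_distr[OF m]
      intro!: restrict_ext PiE_ext)
qed

section \<open>The kernel of the map Def\<close>

lemma carrier_Cl0:
  "carrier (Cl0 W) = {f \<in> extensional (carrier W). f \<one>\<^bsub>W\<^esub> = 0 \<and>
     (\<forall>g \<in> carrier W. \<forall>h \<in> carrier W. f (g \<otimes>\<^bsub>W\<^esub> h \<otimes>\<^bsub>W\<^esub> inv\<^bsub>W\<^esub> g) = f h)}"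
  by (auto simp: Cl0_def PiE_def)

lemma Cl0_ops:
  "\<zero>\<^bsub>Cl0 W\<^esub> = (\<lambda>w \<in> carrier W. 0)"
  "f \<oplus>\<^bsub>Cl0 W\<^esub> g = (\<lambda>w \<in> carrier W. f w + g w)"
  "c \<odot>\<^bsub>Cl0 W\<^esub> f = (\<lambda>w \<in> carrier W. c * f w)"
  by (simp_all add: Cl0_def func_space_F2)

lemma HomF2_iff:
  "f \<in> HomF2 W \<longleftrightarrow> f \<in> extensional (carrier W) \<and>
    (\<forall>x \<in> carrier W. \<forall>y \<in> carrier W. f (x \<otimes>\<^bsub>W\<^esub> y) = f x + f y)"
  by (auto simp: HomF2_def hom_def)

lemma (in group) vectorspace_Cl0: "vectorspace F2 (Cl0 G)"
proof -
  let ?N = "{f \<in> carrier G \<rightarrow>\<^sub>E carrier F2. f \<one> = 0 \<and>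
    (\<forall>g \<in> carrier G. \<forall>h \<in> carrier G. f (g \<otimes> h \<otimes> inv g) = f h)}"
  have "submodule F2 ?N (ring.func_space F2 (carrier G))"
    by (rule submodule.intro)
      (use vectorspace_func_space_F2 in \<open>auto simp: func_space_F2 vectorspace_def\<close>)
  then show ?thesis
    unfolding Cl0_def by (rule vectorspace_submodule[OF vectorspace_func_space_F2])
qed

text \<open>A homomorphism into an abelian group vanishes at 1 and is constant on conjugacy
  classes.\<close>

lemma (in group) submodule_HomF2: "submodule F2 (HomF2 G) (Cl0 G)"
proof (rule submodule.intro)
  show "module F2 (Cl0 G)" using vectorspace_Cl0 by (simp add: vectorspace_def)
  show "HomF2 G \<subseteq> carrier (Cl0 G)"
  proof
    fix f assume f: "f \<in> HomF2 G"
    then have one: "f \<one> = 0" unfolding HomF2_iff by (metis add_cancel_right_right l_one one_closed)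
    have inv: "f (inv g) = f g" if "g \<in> carrier G" for g
    proof -
      have "f g + f (inv g) = 0" using f that one unfolding HomF2_iff by (metis inv_closed r_inv)
      then show ?thesis by (cases "f g"; cases "f (inv g)") auto
    qed
    have "f g + f h + f g = f h" for g h by (cases "f g"; cases "f h") auto
    then have "f (g \<otimes> h \<otimes> inv g) = f h" if "g \<in> carrier G" "h \<in> carrier G" for g h
      using f that inv unfolding HomF2_iff by simp
    then show "f \<in> carrier (Cl0 G)" using f one by (simp add: carrier_Cl0 HomF2_iff)
  qed
qed (auto simp: HomF2_iff Cl0_ops algebra_simps)

lemma (in group) vectorspace_Dfrak: "vectorspace F2 (Dfrak G)"
  unfolding Dfrak_def by (rule vectorspace_quotient_module[OF vectorspace_Cl0 submodule_HomF2])

section \<open>The functions \<lambda> as class functions on Weyl groups\<close>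

context fin_group
begin

text \<open>Conjugation by g preserves K, so it carries \<open><K, h>\<close> onto
  \<open><K, ghg^-1>\<close>. One inclusion, used for g and for its inverse, yields equality by
  comparing orders. This is why \<lambda> is a class function.\<close>

lemma generate_insert_conjugate:
  assumes K: "subgroup K G" and g: "g \<in> normalizer G K" and h: "h \<in> carrier G"
  shows "subgroup_class G (generate G (insert (g \<otimes> h \<otimes> inv g) K)) = subgroup_class G (generate G (insert h K))"
proof -
  have incl: "generate G (insert h K) \<subseteq> inv g <# generate G (insert (g \<otimes> h \<otimes> inv g) K) #> inv (inv g)"
    if g: "g \<in> normalizer G K" and h: "h \<in> carrier G" for g h
  proof (rule generate_subgroup_incl)
    let ?L = "generate G (insert (g \<otimes> h \<otimes> inv g) K)"
    have gG: "g \<in> carrier G" "g <# K #> inv g = K" using g normalizer_iff[OF K] by auto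
    have L: "subgroup ?L G"
      using gG h subgroup.subset[OF K] by (intro generate_is_subgroup) auto
    then show "subgroup (inv g <# ?L #> inv (inv g)) G"
      using gG by (intro subgroup_conjugate) auto
    have "g \<otimes> k \<otimes> inv g \<in> K" if "k \<in> K" for k
      using that gG(2) by (auto simp: l_coset_def r_coset_def)
    then have "g \<otimes> k \<otimes> inv g \<in> ?L" if "k \<in> insert h K" for k
      using that by (auto intro: generate.incl)
    then show "insert h K \<subseteq> inv g <# ?L #> inv (inv g)"
      using gG h subgroup.subset[OF K] mem_conjugate[OF subgroup.subset[OF L], of "inv g"] by auto
  qed
  have gG: "g \<in> carrier G" using g normalizer_iff[OF K] by auto
  let ?L = "generate G (insert h K)" and ?L' = "generate G (insert (g \<otimes> h \<otimes> inv g) K)"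
  have sub: "subgroup ?L G" "subgroup ?L' G"
    using gG h subgroup.subset[OF K] by (auto intro!: generate_is_subgroup)
  have inv_g: "inv g \<in> normalizer G K"
    using g subgroup.m_inv_closed[OF subgroup_normalizer[OF K]] by blast
  have "inv g \<otimes> (g \<otimes> h \<otimes> inv g) \<otimes> inv (inv g) = h"
    using conjugation_is_surj[of "inv g" h] gG h by simp
  then have "?L' \<subseteq> g <# ?L #> inv g"
    using incl[OF inv_g, of "g \<otimes> h \<otimes> inv g"] gG h by simp
  then have "card ?L' \<le> card ?L"
    using card_mono[OF finite_subgroup[OF subgroup_conjugate[OF sub(1) gG]]]
      card_conjugate[OF subgroup.subset[OF sub(1)] gG] by metis
  have "?L \<subseteq> inv g <# ?L' #> inv (inv g)" by (rule incl[OF g h])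
  moreover have "card (inv g <# ?L' #> inv (inv g)) \<le> card ?L"
    using \<open>card ?L' \<le> card ?L\<close> card_conjugate[OF subgroup.subset[OF sub(2)], of "inv g"] gG by simp
  ultimately have eq: "?L = inv g <# ?L' #> inv (inv g)"
    using finite_subgroup[OF subgroup_conjugate[OF sub(2), of "inv g"]] gG by (intro card_seteq) auto
  have "subgroup_class G (inv g <# ?L' #> inv (inv g)) = subgroup_class G ?L'"
    using gG by (intro subgroup_class_conjugate sub) simp
  then show ?thesis unfolding eq[symmetric] by simp
qed

lemma subgroup_generate_coset:
  assumes K: "subgroup K G" and X: "X \<in> carrier (weyl_group G K)"
  shows "subgroup (generate G (K \<union> X)) G"
  using generate_coset_less(1)[OF K X] generate_subgroup[OF K] K by (cases "X = K") auto

lemma lambda_fun_eq: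
  fixes x :: "'a set set \<Rightarrow> bit"
  assumes K: "subgroup K G" and X: "X \<in> carrier (weyl_group G K)"
  defines "y \<equiv> \<lambda>L. if subgroup_class G L \<in> ncc_classes G then x (subgroup_class G L) else 0"
  shows "lambda_fun G x K X = y (generate G (K \<union> X)) + y K"
  using X K subgroup_generate_coset[OF K X]
  by (simp add: lambda_fun_def zero_ext_def y_def subgroup_class_in_classes)

text \<open>This makes the components of Def genuine elements of the quotients. Cosets are lifted to
  the normalizer, where conjugation is explicit.\<close>

lemma lambda_fun_in_Cl0:
  assumes K: "subgroup K G"
  shows "lambda_fun G x K \<in> carrier (Cl0 (weyl_group G K))"
proof -
  interpret W: group "weyl_group G K" by (rule group_weyl_group[OF K])
  have "lambda_fun G x K (X \<otimes>\<^bsub>weyl_group G K\<^esub> Y \<otimes>\<^bsub>weyl_group G K\<^esub> inv\<^bsub>weyl_group G K\<^esub> X) = lambda_fun G x K Y"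
    if XY: "X \<in> carrier (weyl_group G K)" "Y \<in> carrier (weyl_group G K)" for X Y
  proof -
    obtain g h where gh: "g \<in> normalizer G K" "h \<in> normalizer G K" "X = K #> g" "Y = K #> h"
      using XY by (auto simp: carrier_weyl_group)
    have N: "subgroup (normalizer G K) G" by (rule subgroup_normalizer[OF K])
    have G: "g \<in> carrier G" "h \<in> carrier G" using gh normalizer_subset[OF K] by auto
    have ig: "inv g \<in> normalizer G K" using gh(1) subgroup.m_inv_closed[OF N] by blast
    have "inv\<^bsub>weyl_group G K\<^esub> X = K #> inv g"
    proof (rule W.inv_equality)
      show "(K #> inv g) \<otimes>\<^bsub>weyl_group G K\<^esub> X = \<one>\<^bsub>weyl_group G K\<^esub>"
        using mult_weyl_group[OF K ig gh(1)] gh(3) G subgroup.subset[OF K] by simp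
    qed (use XY ig in \<open>auto simp: carrier_weyl_group\<close>)
    then have eq: "X \<otimes>\<^bsub>weyl_group G K\<^esub> Y \<otimes>\<^bsub>weyl_group G K\<^esub> inv\<^bsub>weyl_group G K\<^esub> X = K #> (g \<otimes> h \<otimes> inv g)"
      using gh ig mult_weyl_group[OF K] subgroup.m_closed[OF N] by simp
    have "g \<otimes> h \<otimes> inv g \<in> normalizer G K" using gh ig subgroup.m_closed[OF N] by simp
    then have "K #> (g \<otimes> h \<otimes> inv g) \<in> carrier (weyl_group G K)" by (simp add: carrier_weyl_group)
    then show ?thesis
      unfolding eq using XY(2) gh(4) G
      by (simp add: lambda_fun_def generate_Un_coset[OF K] generate_insert_conjugate[OF K gh(1)])
  qed
  moreover have "K \<in> carrier (weyl_group G K)" using W.one_closed by simp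
  ultimately show ?thesis
    by (simp add: carrier_Cl0 lambda_fun_def generate_subgroup[OF K])
qed

end

section \<open>Linearity and kernel of Def for a choice of representatives\<close>

locale class_transversal = fin_group +
  fixes r :: "'a set set \<Rightarrow> 'a set"
  assumes r_in: "C \<in> subgroup_classes G \<Longrightarrow> r C \<in> C"
begin

abbreviation W where "W C \<equiv> weyl_group G (r C)"

lemma subgroup_r: "C \<in> subgroup_classes G \<Longrightarrow> subgroup (r C) G"
  using r_in subgroup_classesD by blast

lemma group_W: "C \<in> subgroup_classes G \<Longrightarrow> group (W C)"
  by (rule group_weyl_group[OF subgroup_r])

lemma vectorspace_V_space: "vectorspace F2 (V_space G)"
  unfolding V_space_def by (rule vectorspace_func_space_F2)

lemma vectorspace_D_space: "vectorspace F2 (D_space G r)"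
  unfolding D_space_def
  by (rule vectorspace_family_direct_sum[OF field_F2 group.vectorspace_Dfrak[OF group_W]])

lemma lambda_fun_add:
  assumes "subgroup K G"
  shows "lambda_fun G (x \<oplus>\<^bsub>V_space G\<^esub> y) K = lambda_fun G x K \<oplus>\<^bsub>Cl0 (weyl_group G K)\<^esub> lambda_fun G y K"
proof (rule extensionalityI[of _ "carrier (weyl_group G K)"])
  fix X assume X: "X \<in> carrier (weyl_group G K)"
  let ?e = "\<lambda>x L. if subgroup_class G L \<in> ncc_classes G then x (subgroup_class G L) else (0 :: bit)"
  let ?L = "generate G (K \<union> X)"
  have e: "?e (x \<oplus>\<^bsub>V_space G\<^esub> y) L = ?e x L + ?e y L" for L
    by (simp add: V_space_def func_space_F2)
  have "lambda_fun G (x \<oplus>\<^bsub>V_space G\<^esub> y) K X = (?e x ?L + ?e y ?L) + (?e x K + ?e y K)"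
    unfolding lambda_fun_eq[OF assms X] e ..
  also have "\<dots> = (?e x ?L + ?e x K) + (?e y ?L + ?e y K)"
    by (simp only: ac_simps)
  also have "\<dots> = (lambda_fun G x K \<oplus>\<^bsub>Cl0 (weyl_group G K)\<^esub> lambda_fun G y K) X"
    using X by (simp only: lambda_fun_eq[OF assms X] Cl0_ops restrict_apply')
  finally show "lambda_fun G (x \<oplus>\<^bsub>V_space G\<^esub> y) K X = (lambda_fun G x K \<oplus>\<^bsub>Cl0 (weyl_group G K)\<^esub> lambda_fun G y K) X" .
qed (simp_all add: lambda_fun_def Cl0_ops)

lemma lambda_fun_smult:
  assumes "subgroup K G"
  shows "lambda_fun G (c \<odot>\<^bsub>V_space G\<^esub> x) K = c \<odot>\<^bsub>Cl0 (weyl_group G K)\<^esub> lambda_fun G x K"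
proof (rule extensionalityI[of _ "carrier (weyl_group G K)"])
  fix X assume "X \<in> carrier (weyl_group G K)"
  then show "lambda_fun G (c \<odot>\<^bsub>V_space G\<^esub> x) K X = (c \<odot>\<^bsub>Cl0 (weyl_group G K)\<^esub> lambda_fun G x K) X"
    by (simp add: lambda_fun_eq[OF assms] Cl0_ops V_space_def func_space_F2 distrib_left)
qed (simp_all add: lambda_fun_def Cl0_ops)

lemma linear_map_Def: "linear_map F2 (V_space G) (D_space G r) (Def G r)"
proof -
  note q = quotient_module_cosets[OF group.vectorspace_Cl0 group.submodule_HomF2, OF group_W group_W]
  note lam = lambda_fun_in_Cl0[OF subgroup_r]
  have "Def G r \<in> module_hom F2 (V_space G) (D_space G r)"
    unfolding module_hom_def
  proof (intro CollectI conjI allI impI funcsetI)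
    fix x
    show "Def G r x \<in> carrier (D_space G r)"
      by (auto simp: Def_def D_space_def family_direct_sum_def Dfrak_def Dfrak_class_def q lam)
  next
    fix x y
    show "Def G r (x \<oplus>\<^bsub>V_space G\<^esub> y) = Def G r x \<oplus>\<^bsub>D_space G r\<^esub> Def G r y"
      by (auto simp: Def_def D_space_def family_direct_sum_def Dfrak_def Dfrak_class_def q lam lambda_fun_add[OF subgroup_r]
          intro!: restrict_ext)
  next
    fix c x
    show "Def G r (c \<odot>\<^bsub>V_space G\<^esub> x) = c \<odot>\<^bsub>D_space G r\<^esub> Def G r x"
      by (auto simp: Def_def D_space_def family_direct_sum_def Dfrak_def Dfrak_class_def q lam lambda_fun_smult[OF subgroup_r]
          intro!: restrict_ext)
  qed
  then show ?thesis
    using vectorspace_V_space vectorspace_D_space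
    by (simp add: linear_map_def mod_hom_def mod_hom_axioms_def vectorspace_def)
qed

text \<open>A coset is zero exactly when its representative lies in the submodule, and zero in the
  direct sum is tested componentwise.\<close>

lemma Def_eq_zero_iff:
  "Def G r x = \<zero>\<^bsub>D_space G r\<^esub> \<longleftrightarrow> (\<forall>C \<in> subgroup_classes G. lambda_fun G x (r C) \<in> HomF2 (W C))"
proof -
  have "Dfrak_class (W C) (lambda_fun G x (r C)) = \<zero>\<^bsub>Dfrak (W C)\<^esub> \<longleftrightarrow> lambda_fun G x (r C) \<in> HomF2 (W C)"
    if C: "C \<in> subgroup_classes G" for C
    using quotient_module_cosets(5)[OF group.vectorspace_Cl0 group.submodule_HomF2, OF group_W group_W, OF C C
        lambda_fun_in_Cl0[OF subgroup_r[OF C]]]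
    by (simp add: Dfrak_def Dfrak_class_def quotient_module_def)
  moreover have "Def G r x = \<zero>\<^bsub>D_space G r\<^esub> \<longleftrightarrow>
      (\<forall>C \<in> subgroup_classes G. Dfrak_class (W C) (lambda_fun G x (r C)) = \<zero>\<^bsub>Dfrak (W C)\<^esub>)"
    by (auto simp: Def_def D_space_def family_direct_sum_def fun_eq_iff restrict_def)
  ultimately show ?thesis by simp
qed

text \<open>Since S consists of ncc classes, extending its indicator x by 0 gives the indicator of S
  on all classes. So \<lambda> is the function of the two directions of the criterion, read on
  cosets instead of elements.\<close>

lemma S2_sets_iff_lambda:
  assumes S: "S \<subseteq> ncc_classes G"
    and x: "x = (\<lambda>C \<in> ncc_classes G. of_bool (C \<in> S))"
  shows "S \<in> S2_sets G \<longleftrightarrow> (\<forall>C \<in> subgroup_classes G. lambda_fun G x (r C) \<in> HomF2 (W C))"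
proof -
  define z where "z L = (of_bool (subgroup_class G L \<in> S) :: bit)" for L
  have lam: "lambda_fun G x K X = z (generate G (K \<union> X)) + z K"
    if K: "subgroup K G" and X: "X \<in> carrier (weyl_group G K)" for K X
    using K X S by (auto simp: lambda_fun_eq x z_def)
  have ext: "lambda_fun G x K \<in> extensional (carrier (weyl_group G K))" for K
    by (simp add: lambda_fun_def)
  have W_closed: "X \<otimes>\<^bsub>W C\<^esub> Y \<in> carrier (W C)"
    if "C \<in> subgroup_classes G" "X \<in> carrier (W C)" "Y \<in> carrier (W C)" for C X Y
    using group.is_monoid[OF group_W[OF that(1)]] that monoid.m_closed by fast
  show ?thesis
  proof
    assume "S \<in> S2_sets G"
    then obtain u :: "'a set set \<Rightarrow> int"
      where u: "\<And>L. subgroup L G \<Longrightarrow> mark G L u = 2 * of_bool (subgroup_class G L \<in> S)"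
      by (auto simp: S2_sets_iff_marks)
    show "\<forall>C \<in> subgroup_classes G. lambda_fun G x (r C) \<in> HomF2 (W C)"
    proof (unfold HomF2_iff, intro ballI conjI ext)
      fix C X Y assume C: "C \<in> subgroup_classes G" and XY: "X \<in> carrier (W C)" "Y \<in> carrier (W C)"
      have K: "subgroup (r C) G" by (rule subgroup_r[OF C])
      obtain g h where gh: "g \<in> normalizer G (r C)" "h \<in> normalizer G (r C)" "X = r C #> g" "Y = r C #> h"
        using XY by (auto simp: carrier_weyl_group)
      have "g \<in> carrier G" "h \<in> carrier G" using gh normalizer_subset[OF K] by auto
      then have "z (generate G (r C \<union> X \<otimes>\<^bsub>W C\<^esub> Y)) + z (r C)
          = (z (generate G (r C \<union> X)) + z (r C)) + (z (generate G (r C \<union> Y)) + z (r C))"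
        using hom_of_two_marks[OF u K gh(1,2)] mult_weyl_group[OF K gh(1,2)]
        by (simp add: gh(3,4) generate_Un_coset[OF K] z_def)
      then show "lambda_fun G x (r C) (X \<otimes>\<^bsub>W C\<^esub> Y) = lambda_fun G x (r C) X + lambda_fun G x (r C) Y"
        by (simp only: lam[OF K] XY W_closed[OF C XY])
    qed
  next
    assume hom: "\<forall>C \<in> subgroup_classes G. lambda_fun G x (r C) \<in> HomF2 (W C)"
    have "\<exists>u \<in> carrier (burnside_int G). \<forall>K. subgroup K G \<longrightarrow> mark G K u = 2 * of_bool (subgroup_class G K \<in> S)"
    proof (rule two_marks_of_hom[OF r_in])
      fix C X Y assume C: "C \<in> subgroup_classes G" and XY: "X \<in> carrier (W C)" "Y \<in> carrier (W C)"
      have "lambda_fun G x (r C) (X \<otimes>\<^bsub>W C\<^esub> Y) = lambda_fun G x (r C) X + lambda_fun G x (r C) Y"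
        using hom C XY by (simp add: HomF2_iff)
      then show "of_bool (subgroup_class G (generate G (r C \<union> X \<otimes>\<^bsub>W C\<^esub> Y)) \<in> S) + of_bool (subgroup_class G (r C) \<in> S) =
          (of_bool (subgroup_class G (generate G (r C \<union> X)) \<in> S) + of_bool (subgroup_class G (r C) \<in> S)) +
          ((of_bool (subgroup_class G (generate G (r C \<union> Y)) \<in> S) :: bit) + of_bool (subgroup_class G (r C) \<in> S))"
        by (simp only: lam[OF subgroup_r[OF C]] XY W_closed[OF C XY] z_def)
    qed
    then show "S \<in> S2_sets G" using S by (simp add: S2_sets_iff_marks)
  qed
qed

lemma S2_iff: "x \<in> S2 G \<longleftrightarrow> x \<in> carrier (V_space G) \<and> Def G r x = \<zero>\<^bsub>D_space G r\<^esub>"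
proof -
  define ch :: "'a set set set \<Rightarrow> 'a set set \<Rightarrow> bit" where "ch S = (\<lambda>C \<in> ncc_classes G. of_bool (C \<in> S))" for S
  have zero: "Def G r (ch S) = \<zero>\<^bsub>D_space G r\<^esub> \<longleftrightarrow> S \<in> S2_sets G" if "S \<subseteq> ncc_classes G" for S
    using S2_sets_iff_lambda[OF that ch_def] Def_eq_zero_iff by simp
  have carrier: "carrier (V_space G) = ncc_classes G \<rightarrow>\<^sub>E UNIV"
    by (simp add: V_space_def func_space_F2)
  \<comment> \<open>Over F_2 a vector is the indicator of its support.\<close>
  have surj: "x = ch {C \<in> ncc_classes G. x C = 1}" if "x \<in> carrier (V_space G)"
  proof (rule extensionalityI[of _ "ncc_classes G"])
    fix C assume "C \<in> ncc_classes G"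
    then show "x C = ch {C \<in> ncc_classes G. x C = 1} C"
      by (cases "x C") (auto simp: ch_def)
  qed (use that in \<open>auto simp: carrier ch_def PiE_def\<close>)
  have S2: "S2 G = ch ` S2_sets G" by (simp add: S2_def ch_def)
  show ?thesis
  proof
    assume "x \<in> S2 G"
    then obtain S where S: "S \<in> S2_sets G" "x = ch S" unfolding S2 by blast
    moreover have "S \<subseteq> ncc_classes G" using S by (simp add: S2_sets_def)
    ultimately show "x \<in> carrier (V_space G) \<and> Def G r x = \<zero>\<^bsub>D_space G r\<^esub>"
      using zero by (simp add: carrier ch_def)
  next
    assume x: "x \<in> carrier (V_space G) \<and> Def G r x = \<zero>\<^bsub>D_space G r\<^esub>"
    then have "{C \<in> ncc_classes G. x C = 1} \<in> S2_sets G"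
      using zero[of "{C \<in> ncc_classes G. x C = 1}"] surj by auto
    then show "x \<in> S2 G" unfolding S2 using surj x by blast
  qed
qed

end

theorem theorem6p9:
  fixes G :: "('a, 'b) monoid_scheme"
    and r :: "'a set set \<Rightarrow> 'a set"
  assumes "group G" and "finite (carrier G)"
    and "\<And>C. C \<in> subgroup_classes G \<Longrightarrow> r C \<in> C"
  shows "linear_map F2 (V_space G) (D_space G r) (Def G r)
    \<and> mod_hom.ker (V_space G) (D_space G r) (Def G r) = S2 G
    \<and> short_exact_vs F2
        ((V_space G)\<lparr>carrier := S2 G\<rparr>)
        (V_space G)
        ((D_space G r)\<lparr>carrier := mod_hom.im (V_space G) (Def G r)\<rparr>)
        (\<lambda>x. x) (Def G r)
    \<and> int (vectorspace.dim F2 ((V_space G)\<lparr>carrier := S2 G\<rparr>))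
        = int (card (ncc_classes G))
          - int (vectorspace.dim F2 ((D_space G r)\<lparr>carrier := mod_hom.im (V_space G) (Def G r)\<rparr>))"
proof -
  interpret group G by fact
  interpret class_transversal G r
    by unfold_locales (use assms in auto)
  let ?V = "V_space G" and ?D = "D_space G r" and ?d = "Def G r"
  interpret L: linear_map F2 ?V ?D ?d by (rule linear_map_Def)
  have ker: "mod_hom.ker ?V ?D ?d = S2 G"
    using S2_iff by (auto simp: L.ker_def)
  have vsS: "vectorspace F2 (?V\<lparr>carrier := S2 G\<rparr>)"
    using vectorspace_submodule[OF vectorspace_V_space L.ker_is_submodule] by (simp add: ker)
  have vsI: "vectorspace F2 (?D\<lparr>carrier := mod_hom.im ?V ?d\<rparr>)"
    by (rule vectorspace_submodule[OF vectorspace_D_space L.im_is_submodule])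
  have incl: "linear_map F2 (?V\<lparr>carrier := S2 G\<rparr>) ?V (\<lambda>x. x)"
    using vsS vectorspace_V_space S2_iff
    by (auto simp: linear_map_def mod_hom_def mod_hom_axioms_def vectorspace_def module_hom_def)
  have onto: "linear_map F2 ?V (?D\<lparr>carrier := mod_hom.im ?V ?d\<rparr>) ?d"
    using vsI vectorspace_V_space
    by (auto simp: linear_map_def mod_hom_def mod_hom_axioms_def vectorspace_def module_hom_def L.im_def)
  have "short_exact_vs F2 (?V\<lparr>carrier := S2 G\<rparr>) ?V (?D\<lparr>carrier := mod_hom.im ?V ?d\<rparr>) (\<lambda>x. x) ?d"
  proof -
    note i = linear_map.axioms(3)[OF incl] and o = linear_map.axioms(3)[OF onto]
    have "\<zero>\<^bsub>?V\<^esub> \<in> S2 G" using ker L.ker_is_submodule submodule.zero_closed by metis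
    \<comment> \<open>The restricted record keeps the zero of V_G, so the kernel of the inclusion is
      that zero as soon as it lies in \<open>S2 G\<close>.\<close>
    then have "mod_hom.ker (?V\<lparr>carrier := S2 G\<rparr>) ?V (\<lambda>x. x) = {\<zero>\<^bsub>?V\<lparr>carrier := S2 G\<rparr>\<^esub>}"
      unfolding mod_hom.ker_def[OF i] by auto
    moreover have "mod_hom.im (?V\<lparr>carrier := S2 G\<rparr>) (\<lambda>x. x) = mod_hom.ker ?V (?D\<lparr>carrier := mod_hom.im ?V ?d\<rparr>) ?d"
      using ker unfolding mod_hom.im_def[OF i] mod_hom.ker_def[OF o] L.ker_def by simp
    ultimately show ?thesis
      using incl onto by (simp add: short_exact_vs_def)
  qed
  moreover have "int (vectorspace.dim F2 (?V\<lparr>carrier := S2 G\<rparr>))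
      = int (card (ncc_classes G)) - int (vectorspace.dim F2 (?D\<lparr>carrier := mod_hom.im ?V ?d\<rparr>))"
  proof -
    have "finite (ncc_classes G)"
      using ncc_classes_subset finite_subset finite_subgroup_classes by blast
    \<comment> \<open>Rank and nullity add up to the number of ncc classes; the casts to
      \<open>int\<close> keep the subtraction from being truncated.\<close>
    from func_space_F2_dim[OF this] show ?thesis
      using L.rank_nullity by (simp add: V_space_def[symmetric] ker)
  qed
  ultimately show ?thesis
    using linear_map_Def ker by blast
qed

end
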